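(* For every integer $k \ge 4$ there exist a $k$-uniform hypergraph $F$ and constants $\theta$, $c>0$, $C>0$ with $1 < \theta < m_k(F)$ such that $$\lim_{n\to\infty} \Pr[H^k(n,p) \rightarrow (F)] = \begin{cases} 0 & \text{if } p \le c n^{-1/\theta},\\ 1 & \text{if } p \ge C n^{-1/\theta}.\end{cases}$$
   Context: $H^k(n,p)$ is the random $k$-uniform hypergraph on $n$ vertices in which each $k$-element subset of the vertex set is an edge independently with probability $p$. For hypergraphs $G,F$, $G \rightarrow (F)$ means that every colouring of the edges of $G$ with 2 colours contains a monochromatic copy of $F$ (a subhypergraph isomorphic to $F$ all of whose edges have the same colour). For a $k$-uniform hypergraph $G$ with $e(G)$ edges and $v(G)$ vertices let $d_k(G)=0$ if $e(G)=0$, $d_k(G)=1/k$ if $e(G)=1$ and $v(G)=k$, and $d_k(G)=\frac{e(G)-1}{v(G)-k}$ otherwise; the $k$-density is $m_k(G)=\max_{H\subseteq G} d_k(H)$. *)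

theory Defs
  imports "HOL-Probability.Probability" "HOL-Library.Ramsey"
begin

type_synonym 'a hypergraph = "'a set \<times> 'a set set"

abbreviation hverts :: "'a hypergraph \<Rightarrow> 'a set" where
  "hverts \<equiv> fst"

abbreviation hedges :: "'a hypergraph \<Rightarrow> 'a set set" where
  "hedges \<equiv> snd"

definition uniform_hypergraph :: "nat \<Rightarrow> 'a hypergraph \<Rightarrow> bool" where
  "uniform_hypergraph k G \<longleftrightarrow> finite (hverts G) \<and> hedges G \<subseteq> nsets (hverts G) k"

definition subhypergraph :: "'a hypergraph \<Rightarrow> 'a hypergraph \<Rightarrow> bool" where
  "subhypergraph H G \<longleftrightarrow>
     hverts H \<subseteq> hverts G \<and> hedges H \<subseteq> hedges G \<and> hedges H \<subseteq> Pow (hverts H)"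

definition hypergraph_iso :: "'a hypergraph \<Rightarrow> 'b hypergraph \<Rightarrow> bool" where
  "hypergraph_iso G H \<longleftrightarrow>
     (\<exists>f. bij_betw f (hverts G) (hverts H) \<and> (\<lambda>e. f ` e) ` hedges G = hedges H)"

text \<open>
  The two colours are the elements of \<^typ>\<open>bool\<close>; the values of a colouring outside the
  edge set are irrelevant.
\<close>

definition arrows :: "'a hypergraph \<Rightarrow> 'b hypergraph \<Rightarrow> bool" where
  "arrows G F \<longleftrightarrow>
     (\<forall>col :: 'a set \<Rightarrow> bool. \<exists>H b.
        subhypergraph H G \<and> hypergraph_iso H F \<and> (\<forall>e\<in>hedges H. col e = b))"

definition d_density :: "nat \<Rightarrow> 'a hypergraph \<Rightarrow> real" where
  "d_density k G =
     (if card (hedges G) = 0 then 0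
      else if card (hedges G) = 1 \<and> card (hverts G) = k then 1 / real k
      else (real (card (hedges G)) - 1) / (real (card (hverts G)) - real k))"

definition m_density :: "nat \<Rightarrow> 'a hypergraph \<Rightarrow> real" where
  "m_density k G = Max {d_density k H | H. subhypergraph H G}"

definition random_hypergraph :: "nat \<Rightarrow> nat \<Rightarrow> real \<Rightarrow> nat hypergraph pmf" where
  "random_hypergraph k n p =
     map_pmf (\<lambda>X. ({..<n}, {e \<in> nsets {..<n} k. X e}))
       (Pi_pmf (nsets {..<n} k) False (\<lambda>_. bernoulli_pmf p))"

end

theory Submission
  imports Defs "HOL-Real_Asymp.Real_Asymp"
begin

text \<open>
  \<open>F\<close> is the disjoint union of a triangle, that is three edges on \<open>k + 1\<close> vertices, and a star of
  \<open>t = 12 k\<^sup>2\<close> edges sharing \<open>k - 1\<close> vertices; \<open>\<theta> = 3/2\<close>, while the triangle alone has \<open>k\<close>-density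
  \<open>2\<close>. In one of the two colours a triangle appears much earlier, because five of the edges on
  \<open>k + 1 \<ge> 5\<close> vertices contain three of one colour, and so does a star. So the threshold is that of
  avoiding red triangles and blue stars.

  If \<open>p = C n\<^bsup>-2/3\<^esup>\<close>, consider the link graph of a fixed \<open>(k - 2)\<close>-set. A blue colour class
  without a star has bounded degree there, hence \<open>O(n)\<close> edges, and almost all triangles are
  edge-disjoint, so it cannot meet all of the about \<open>C\<^sup>3 n\<close> triangles, and one of them is red.

  If \<open>p = c n\<^bsup>-2/3\<^esup>\<close>, suppose that every colouring has a red triangle or a blue star. An edge-minimal
  set with this property is stuck: each of its edges lies in a triangle and contains a \<open>(k - 1)\<close>-set
  of degree at least \<open>t\<close>. A stuck set of size \<open>s\<close> spans at most \<open>7 s / 12\<close> vertices, so small ones do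
  not occur by the union bound. Exploring a stuck set triangle by triangle is a branching process that
  is subcritical for small \<open>c\<close>, so that it closes up to a small stuck set.
\<close>

section \<open>Triangles and stars\<close>

text \<open>In the link of the \<open>k - 2\<close> points that the three edges share, \<open>T\<close> is a graph triangle.\<close>

definition triangle :: "nat \<Rightarrow> 'a set set \<Rightarrow> bool" where
  "triangle k T \<longleftrightarrow> card T = 3 \<and> (\<forall>e\<in>T. card e = k) \<and> card (\<Union>T) = Suc k"

definition facets :: "'a set \<Rightarrow> 'a set \<Rightarrow> 'a set set" where
  "facets W A = (\<lambda>v. W - {v}) ` A"

definition codegree :: "'a set set \<Rightarrow> 'a set \<Rightarrow> nat" where
  "codegree E S = card {e \<in> E. S \<subseteq> e}"

definition heavy_sets :: "nat \<Rightarrow> nat \<Rightarrow> 'a set set \<Rightarrow> 'a set set" where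
  "heavy_sets k t E = {S. card S = k - 1 \<and> t \<le> codegree E S}"

definition has_triangle :: "nat \<Rightarrow> 'a set set \<Rightarrow> bool" where
  "has_triangle k E \<longleftrightarrow> (\<exists>T\<subseteq>E. triangle k T)"

definition has_star :: "nat \<Rightarrow> nat \<Rightarrow> 'a set set \<Rightarrow> bool" where
  "has_star k t E \<longleftrightarrow> heavy_sets k t E \<noteq> {}"

lemma finite_facets: "finite A \<Longrightarrow> finite (facets W A)"
  by (simp add: facets_def)

lemma card_facets:
  assumes "A \<subseteq> W"
  shows "card (facets W A) = card A"
  unfolding facets_def using assms by (intro card_image inj_onI) blast

lemma facets_subset_nsets:
  assumes "A \<subseteq> W" "W \<subseteq> V" "finite W" "card W = Suc k"
  shows "facets W A \<subseteq> nsets V k"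
  using assms by (auto simp: facets_def nsets_def)

lemma Union_facets:
  assumes "A \<subseteq> W" "2 \<le> card A"
  shows "\<Union>(facets W A) = W"
proof
  show "W \<subseteq> \<Union>(facets W A)"
  proof
    fix x assume "x \<in> W"
    have "\<not> A \<subseteq> {x}" using assms(2) card_mono[of "{x}" A] by auto
    then show "x \<in> \<Union>(facets W A)" using \<open>x \<in> W\<close> by (auto simp: facets_def)
  qed
qed (auto simp: facets_def)

lemma triangle_facets:
  assumes "card W = Suc k" "A \<subseteq> W" "card A = 3"
  shows "triangle k (facets W A)"
  unfolding triangle_def
proof (intro conjI)
  show "\<forall>e\<in>facets W A. card e = k"
    using assms(1,2) by (auto simp: facets_def card_Diff_singleton_if)
qed (use assms in \<open>simp_all add: card_facets Union_facets\<close>)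

lemma triangleD:
  assumes "triangle k T"
  shows "finite T" "card T = 3" "finite (\<Union>T)" "card (\<Union>T) = Suc k" "T \<subseteq> nsets UNIV k"
proof -
  show "card T = 3" and Union: "card (\<Union>T) = Suc k" using assms by (simp_all add: triangle_def)
  then show "finite T" "finite (\<Union>T)" by (auto intro: card_ge_0_finite)
  then show "T \<subseteq> nsets UNIV k" using assms
    by (auto simp: triangle_def nsets_def intro: finite_subset)
qed

lemma triangle_Union_insert:
  assumes "triangle k T" "e \<in> T"
  shows "\<exists>y\<in>\<Union>T. y \<notin> e \<and> \<Union>T = insert y e"
proof -
  have "card (\<Union>T - e) = 1"
    using assms triangleD(3,4)[OF assms(1)]
    by (subst card_Diff_subset) (auto simp: triangle_def intro: finite_subset)
  then obtain y where "\<Union>T - e = {y}" by (auto simp: card_1_singleton_iff)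
  then show ?thesis using assms(2) by blast
qed

lemma triangle_eq_facets:
  assumes "triangle k T"
  obtains A where "A \<subseteq> \<Union>T" "card A = 3" "T = facets (\<Union>T) A"
proof
  let ?A = "{v \<in> \<Union>T. \<Union>T - {v} \<in> T}"
  show T_eq: "T = facets (\<Union>T) ?A"
  proof
    show "T \<subseteq> facets (\<Union>T) ?A"
    proof
      fix e assume "e \<in> T"
      then obtain y where "y \<in> \<Union>T" "y \<notin> e" "\<Union>T = insert y e"
        using triangle_Union_insert[OF assms] by blast
      then have "e = \<Union>T - {y}" by blast
      then show "e \<in> facets (\<Union>T) ?A" using \<open>e \<in> T\<close> \<open>y \<in> \<Union>T\<close> by (auto simp: facets_def)
    qed
  qed (auto simp: facets_def)
  have "card ?A = card (facets (\<Union>T) ?A)" by (intro card_facets[symmetric]) blast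
  also have "\<dots> = 3" unfolding T_eq[symmetric] by (rule triangleD(2)[OF assms])
  finally show "card ?A = 3" .
qed blast

lemma triangle_Union_Un:
  assumes "triangle k T" "e \<in> T" "f \<in> T" "e \<noteq> f"
  shows "\<Union>T = e \<union> f"
proof -
  obtain y where Union_eq: "\<Union>T = insert y e" using triangle_Union_insert[OF assms(1,2)] by blast
  have "finite e" "card e = card f"
    using assms(2,3) triangleD(5)[OF assms(1)] by (auto simp: nsets_def)
  then have "\<not> f \<subseteq> e" using assms(4) card_subset_eq by metis
  moreover have "f \<subseteq> insert y e" using assms(3) Union_eq by blast
  ultimately show ?thesis unfolding Union_eq by blast
qed

lemma two_le_codegree_triangle:
  assumes "triangle k T" "x \<in> \<Union>T"
  shows "2 \<le> codegree T {x}"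
proof -
  have "e = \<Union>T - {x}" if "e \<in> T" "x \<notin> e" for e
  proof -
    obtain y where missing: "y \<notin> e" "\<Union>T = insert y e"
      using triangle_Union_insert[OF assms(1) \<open>e \<in> T\<close>] by blast
    then have "y = x" using assms(2) \<open>x \<notin> e\<close> by simp
    then show ?thesis using missing by simp
  qed
  then have "T \<subseteq> insert (\<Union>T - {x}) {e \<in> T. {x} \<subseteq> e}" by blast
  then have "card T \<le> card (insert (\<Union>T - {x}) {e \<in> T. {x} \<subseteq> e})"
    using triangleD(1)[OF assms(1)] by (intro card_mono) auto
  also have "\<dots> \<le> Suc (codegree T {x})"
    unfolding codegree_def by (rule card_insert_le_m1) auto
  finally show ?thesis using triangleD(2)[OF assms(1)] by simp
qed

lemma codegree_mono:
  assumes "E \<subseteq> E'" "finite E'"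
  shows "codegree E S \<le> codegree E' S"
  unfolding codegree_def using assms by (intro card_mono) auto

lemma heavy_sets_mono:
  assumes "E \<subseteq> E'" "finite E'"
  shows "heavy_sets k t E \<subseteq> heavy_sets k t E'"
  using codegree_mono[OF assms] by (auto simp: heavy_sets_def intro: order_trans)

lemma has_triangle_mono: "has_triangle k E \<Longrightarrow> E \<subseteq> E' \<Longrightarrow> has_triangle k E'"
  by (auto simp: has_triangle_def)

lemma has_star_mono: "has_star k t E \<Longrightarrow> E \<subseteq> E' \<Longrightarrow> finite E' \<Longrightarrow> has_star k t E'"
  using heavy_sets_mono[of E E' k t] by (auto simp: has_star_def)

section \<open>Stuck edge sets\<close>

definition forces :: "('a set \<Rightarrow> bool) \<Rightarrow> ('a set \<Rightarrow> bool) \<Rightarrow> 'a set \<Rightarrow> bool" where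
  "forces P Q E \<longleftrightarrow> (\<forall>R\<subseteq>E. P R \<or> Q (E - R))"

definition triangle_covered :: "nat \<Rightarrow> 'a set set \<Rightarrow> bool" where
  "triangle_covered k E \<longleftrightarrow> (\<forall>e\<in>E. \<exists>T\<subseteq>E. e \<in> T \<and> triangle k T)"

definition stuck :: "nat \<Rightarrow> nat \<Rightarrow> 'a set set \<Rightarrow> bool" where
  "stuck k t E \<longleftrightarrow> E \<noteq> {} \<and> triangle_covered k E \<and> (\<forall>e\<in>E. \<exists>S\<in>heavy_sets k t E. S \<subseteq> e)"

lemma triangle_covered_nsets: "triangle_covered k E \<Longrightarrow> E \<subseteq> nsets UNIV k"
  using triangleD(5) unfolding triangle_covered_def by fast

lemma minimal_forces_imp_stuck:
  assumes "finite E" "0 < t" and forces: "forces (has_triangle k) (has_star k t) E"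
    and minimal: "\<And>e. e \<in> E \<Longrightarrow> \<not> forces (has_triangle k) (has_star k t) (E - {e})"
  shows "stuck k t E"
proof -
  have "\<not> forces (has_triangle k) (has_star k t) {}"
    using \<open>0 < t\<close>
    by (auto simp: forces_def has_triangle_def has_star_def heavy_sets_def codegree_def triangle_def)
  then have "E \<noteq> {}" using forces by auto
  moreover have "(\<exists>T\<subseteq>E. e \<in> T \<and> triangle k T) \<and> (\<exists>S\<in>heavy_sets k t E. S \<subseteq> e)" if "e \<in> E" for e
  proof
    obtain R where R: "R \<subseteq> E - {e}" "\<not> has_triangle k R" "\<not> has_star k t (E - {e} - R)"
      using minimal[OF \<open>e \<in> E\<close>] by (auto simp: forces_def)
    have "E - insert e R = E - {e} - R" by blast
    then have "has_triangle k (insert e R)"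
      using forces R \<open>e \<in> E\<close> unfolding forces_def by (metis Diff_subset insert_subset subset_trans)
    then obtain T where T: "T \<subseteq> insert e R" "triangle k T" by (auto simp: has_triangle_def)
    moreover have "\<not> T \<subseteq> R" using R(2) T(2) by (auto simp: has_triangle_def)
    ultimately show "\<exists>T\<subseteq>E. e \<in> T \<and> triangle k T"
      using R(1) \<open>e \<in> E\<close> by (intro exI[of _ T]) blast
    have "has_star k t (E - R)" using forces R(1,2) by (auto simp: forces_def)
    then obtain S where S: "S \<in> heavy_sets k t (E - R)" by (auto simp: has_star_def)
    have "S \<subseteq> e"
    proof (rule ccontr)
      assume "\<not> S \<subseteq> e"
      then have "{f \<in> E - R. S \<subseteq> f} = {f \<in> E - {e} - R. S \<subseteq> f}" by blast
      then have "S \<in> heavy_sets k t (E - {e} - R)"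
        using S by (simp add: heavy_sets_def codegree_def)
      then show False using R(3) by (auto simp: has_star_def)
    qed
    moreover have "S \<in> heavy_sets k t E"
      using S heavy_sets_mono[OF Diff_subset assms(1)] by blast
    ultimately show "\<exists>S\<in>heavy_sets k t E. S \<subseteq> e" by blast
  qed
  ultimately show ?thesis by (auto simp: stuck_def triangle_covered_def)
qed

lemma forces_imp_stuck_subset:
  assumes "finite E" "0 < t" "forces (has_triangle k) (has_star k t) E"
  shows "\<exists>E'\<subseteq>E. stuck k t E'"
proof -
  have "finite {E'. E' \<subseteq> E \<and> forces (has_triangle k) (has_star k t) E'}" using assms(1) by simp
  from finite_has_minimal2[OF this, of E] assms(3)
  obtain E' where E': "E' \<subseteq> E" "forces (has_triangle k) (has_star k t) E'"
    and minimal: "\<And>D. D \<subseteq> E' \<Longrightarrow> forces (has_triangle k) (has_star k t) D \<Longrightarrow> E' = D"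
    by (auto 4 3)
  have "\<not> forces (has_triangle k) (has_star k t) (E' - {e})" if "e \<in> E'" for e
    using minimal[of "E' - {e}"] that by blast
  then have "stuck k t E'"
    using minimal_forces_imp_stuck[OF finite_subset[OF E'(1) assms(1)] assms(2) E'(2)] by blast
  then show ?thesis using E'(1) by blast
qed

section \<open>Density of stuck sets\<close>

lemma codegree_double_count:
  assumes "finite \<S>" "finite E"
  shows "(\<Sum>S\<in>\<S>. codegree E S) = (\<Sum>e\<in>E. card {S \<in> \<S>. S \<subseteq> e})"
  unfolding codegree_def using assms by (intro sum_multicount_gen) simp_all

lemma heavy_sets_subset_edge:
  assumes "0 < t" "S \<in> heavy_sets k t E"
  shows "\<exists>e\<in>E. S \<subseteq> e"
proof -
  have "{e \<in> E. S \<subseteq> e} \<noteq> {}" using assms unfolding heavy_sets_def codegree_def by force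
  then show ?thesis by blast
qed

lemma finite_heavy_sets:
  assumes "finite (\<Union>E)" "0 < t"
  shows "finite (heavy_sets k t E)"
proof (rule finite_subset)
  show "heavy_sets k t E \<subseteq> Pow (\<Union>E)" using heavy_sets_subset_edge[OF assms(2)] by blast
qed (use assms(1) in simp)

lemma card_heavy_sets_le:
  assumes "finite E" "E \<subseteq> nsets V k" "1 \<le> k" "0 < t"
  shows "t * card (heavy_sets k t E) \<le> k * card E"
proof -
  have fin: "finite (heavy_sets k t E)"
    using assms by (intro finite_heavy_sets) (auto simp: nsets_def)
  have "t * card (heavy_sets k t E) = (\<Sum>S\<in>heavy_sets k t E. t)" by simp
  also have "\<dots> \<le> (\<Sum>S\<in>heavy_sets k t E. codegree E S)"
    by (intro sum_mono) (simp add: heavy_sets_def)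
  also have "\<dots> = (\<Sum>e\<in>E. card {S \<in> heavy_sets k t E. S \<subseteq> e})"
    by (rule codegree_double_count[OF fin assms(1)])
  also have "\<dots> \<le> (\<Sum>e\<in>E. k)"
  proof (intro sum_mono)
    fix e assume "e \<in> E"
    then have edge: "finite e" "card e = k" using assms(2) by (auto simp: nsets_def)
    have "card {S \<in> heavy_sets k t E. S \<subseteq> e} \<le> card (nsets e (k - 1))"
      using edge(1) by (intro card_mono finite_imp_finite_nsets)
        (auto simp: heavy_sets_def nsets_def intro: finite_subset)
    also have "\<dots> = k" using edge assms(3) binomial_symmetric[of "k - 1" k] by simp
    finally show "card {S \<in> heavy_sets k t E. S \<subseteq> e} \<le> k" .
  qed
  finally show ?thesis by (simp add: mult.commute)
qed

lemma card_stuck_light_vertices_le: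
  assumes "stuck k t E" "finite E" "1 \<le> k"
  shows "2 * card (\<Union>E - \<Union>(heavy_sets k t E)) \<le> card E"
proof -
  let ?W = "\<Union>E - \<Union>(heavy_sets k t E)"
  have cover: "triangle_covered k E" using assms(1) by (simp add: stuck_def)
  have E_sub: "E \<subseteq> nsets UNIV k" using triangle_covered_nsets[OF cover] .
  have fin_W: "finite ?W" using E_sub assms(2) by (auto simp: nsets_def)
  have "2 * card ?W = (\<Sum>x\<in>?W. 2)" by simp
  also have "\<dots> \<le> (\<Sum>x\<in>?W. codegree E {x})"
  proof (intro sum_mono)
    fix x assume "x \<in> ?W"
    then obtain e T where "x \<in> e" "e \<in> T" "T \<subseteq> E" "triangle k T"
      using cover by (auto simp: triangle_covered_def)
    then have "2 \<le> codegree T {x}" by (intro two_le_codegree_triangle) auto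
    also have "\<dots> \<le> codegree E {x}" using \<open>T \<subseteq> E\<close> assms(2) by (rule codegree_mono)
    finally show "2 \<le> codegree E {x}" .
  qed
  also have "\<dots> = (\<Sum>e\<in>E. card {x \<in> ?W. x \<in> e})"
    unfolding codegree_def using fin_W assms(2) by (intro sum_multicount_gen) simp_all
  also have "\<dots> \<le> (\<Sum>e\<in>E. 1)"
  proof (intro sum_mono)
    fix e assume "e \<in> E"
    then have edge: "finite e" "card e = k" using E_sub by (auto simp: nsets_def)
    obtain S where S: "S \<in> heavy_sets k t E" "S \<subseteq> e"
      using assms(1) \<open>e \<in> E\<close> by (auto simp: stuck_def)
    have "card {x \<in> ?W. x \<in> e} \<le> card (e - S)" using S(1) edge(1) by (intro card_mono) auto
    also have "\<dots> = 1"
      using S edge assms(3) by (simp add: card_Diff_subset finite_subset heavy_sets_def)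
    finally show "card {x \<in> ?W. x \<in> e} \<le> 1" .
  qed
  finally show ?thesis by simp
qed

lemma stuck_imp_few_vertices:
  assumes "stuck k t E" "finite E" "1 \<le> k" "0 < t"
  shows "2 * t * card (\<Union>E) \<le> (t + 2 * k * (k - 1)) * card E"
proof -
  let ?H = "heavy_sets k t E"
  have E_sub: "E \<subseteq> nsets UNIV k" using assms(1) triangle_covered_nsets by (auto simp: stuck_def)
  then have fin_V: "finite (\<Union>E)" using assms(2) by (auto simp: nsets_def)
  have "\<Union>?H \<subseteq> \<Union>E" using heavy_sets_subset_edge[OF assms(4)] by blast
  then have "card (\<Union>E) = card (\<Union>E - \<Union>?H) + card (\<Union>?H)"
    using fin_V finite_subset[OF _ fin_V] card_mono[of "\<Union>E" "\<Union>?H"]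
    by (simp add: card_Diff_subset)
  also have "card (\<Union>?H) \<le> (\<Sum>S\<in>?H. card S)" by (rule card_Union_le_sum_card)
  also have "\<dots> = (k - 1) * card ?H" by (simp add: heavy_sets_def)
  finally have "card (\<Union>E) \<le> card (\<Union>E - \<Union>?H) + (k - 1) * card ?H" by simp
  then have "2 * t * card (\<Union>E) \<le> 2 * t * (card (\<Union>E - \<Union>?H) + (k - 1) * card ?H)"
    by (rule mult_le_mono2)
  also have "\<dots> = t * (2 * card (\<Union>E - \<Union>?H)) + 2 * (k - 1) * (t * card ?H)"
    by (simp only: add_mult_distrib2 mult_ac)
  also have "\<dots> \<le> t * card E + 2 * (k - 1) * (k * card E)"
    by (intro add_mono mult_le_mono2 card_stuck_light_vertices_le card_heavy_sets_le[OF assms(2) E_sub])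
      (use assms in auto)
  also have "\<dots> = (t + 2 * k * (k - 1)) * card E"
    by (simp only: add_mult_distrib add_mult_distrib2 mult_ac)
  finally show ?thesis .
qed

section \<open>Random subsets\<close>

definition random_subset :: "'a set \<Rightarrow> real \<Rightarrow> 'a set pmf" where
  "random_subset I p = map_pmf (\<lambda>X. {e \<in> I. X e}) (Pi_pmf I False (\<lambda>_. bernoulli_pmf p))"

lemma random_hypergraph_conv_random_subset:
  "random_hypergraph k n p = map_pmf (Pair {..<n}) (random_subset (nsets {..<n} k) p)"
  by (simp add: random_hypergraph_def random_subset_def pmf.map_comp o_def)

lemma set_pmf_random_subset: "set_pmf (random_subset I p) \<subseteq> Pow I"
  by (auto simp: random_subset_def)

lemma integrable_random_subset:
  fixes f :: "'a set \<Rightarrow> real"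
  assumes "finite I"
  shows "integrable (measure_pmf (random_subset I p)) f"
  using finite_subset[OF set_pmf_random_subset[of I p]] assms
  by (intro integrable_measure_pmf_finite) simp

lemma prob_disj_le:
  "measure_pmf.prob M {x. P x \<or> Q x} \<le> measure_pmf.prob M {x. P x} + measure_pmf.prob M {x. Q x}"
  unfolding Collect_disj_eq by (rule measure_Un_le) simp_all

lemma prob_random_subset_le_if_imp:
  assumes "\<And>E. E \<subseteq> I \<Longrightarrow> P E \<Longrightarrow> Q E"
  shows "measure_pmf.prob (random_subset I p) {E. P E} \<le> measure_pmf.prob (random_subset I p) {E. Q E}"
  using assms set_pmf_random_subset[of I p]
  by (intro measure_pmf.finite_measure_mono_AE) (auto simp: AE_measure_pmf_iff)

lemma random_subset_insert:
  assumes "finite I" "x \<notin> I"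
  shows "random_subset (insert x I) p =
    bind_pmf (bernoulli_pmf p) (\<lambda>b. map_pmf (\<lambda>E. if b then insert x E else E) (random_subset I p))"
  using assms unfolding random_subset_def
  by (simp add: Pi_pmf_insert' map_bind_pmf pmf.map_comp o_def flip: map_pmf_def)
    (auto split: if_splits intro!: bind_pmf_cong map_pmf_cong)

lemma prob_random_subset_superset:
  assumes "finite I" "A \<subseteq> I" "0 \<le> p" "p \<le> 1"
  shows "measure_pmf.prob (random_subset I p) {E. A \<subseteq> E} = p ^ card A"
proof -
  have "(\<lambda>X. {e \<in> I. X e}) -` {E. A \<subseteq> E} = Pi I (\<lambda>e. if e \<in> A then {True} else UNIV)"
    using assms(2) by (fastforce simp: Pi_def)
  then have "measure_pmf.prob (random_subset I p) {E. A \<subseteq> E} =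
      (\<Prod>e\<in>I. measure_pmf.prob (bernoulli_pmf p) (if e \<in> A then {True} else UNIV))"
    using assms(1) by (simp add: random_subset_def measure_Pi_pmf_Pi)
  also have "\<dots> = (\<Prod>e\<in>I. if e \<in> A then p else 1)"
    using assms by (intro prod.cong) (auto simp: measure_pmf_single)
  also have "\<dots> = p ^ card A"
    using assms(1,2) by (simp add: prod.If_cases Int_absorb1)
  finally show ?thesis .
qed

lemma prob_random_subset_union_bound:
  assumes "finite I" "finite J" "\<And>j. j \<in> J \<Longrightarrow> A j \<subseteq> I" "0 \<le> p" "p \<le> 1"
  shows "measure_pmf.prob (random_subset I p) {E. \<exists>j\<in>J. A j \<subseteq> E} \<le> (\<Sum>j\<in>J. p ^ card (A j))"
proof -
  have "{E. \<exists>j\<in>J. A j \<subseteq> E} = (\<Union>j\<in>J. {E. A j \<subseteq> E})" by auto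
  also have "measure_pmf.prob (random_subset I p) \<dots> \<le>
      (\<Sum>j\<in>J. measure_pmf.prob (random_subset I p) {E. A j \<subseteq> E})"
    using assms(2) by (intro measure_pmf.finite_measure_subadditive_finite) auto
  also have "\<dots> = (\<Sum>j\<in>J. p ^ card (A j))"
    using assms by (intro sum.cong refl prob_random_subset_superset) auto
  finally show ?thesis .
qed

lemma rel_pmf_bernoulli:
  assumes "0 \<le> p" "p \<le> q" "q \<le> 1"
  shows "rel_pmf (\<longrightarrow>) (bernoulli_pmf p) (bernoulli_pmf q)"
proof (rule rel_pmf.intros)
  define pq where
    "pq = bind_pmf (bernoulli_pmf q) (\<lambda>b. map_pmf (\<lambda>a. (a \<and> b, b)) (bernoulli_pmf (p / q)))"
  have "map_pmf fst pq = bind_pmf (bernoulli_pmf q)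
      (\<lambda>b. if b then bernoulli_pmf (p / q) else return_pmf False)"
    by (auto simp: pq_def map_bind_pmf pmf.map_comp o_def if_distrib map_pmf_const intro!: bind_pmf_cong)
  also have "\<dots> = bernoulli_pmf p"
  proof (rule pmf_eqI)
    fix b
    show "pmf (bind_pmf (bernoulli_pmf q)
        (\<lambda>b. if b then bernoulli_pmf (p / q) else return_pmf False)) b = pmf (bernoulli_pmf p) b"
      using assms by (cases b; cases "q = 0") (auto simp: pmf_bind field_simps)
  qed
  finally show "map_pmf fst pq = bernoulli_pmf p" .
  show "map_pmf snd pq = bernoulli_pmf q"
    by (simp add: pq_def map_bind_pmf pmf.map_comp o_def map_pmf_const bind_return_pmf')
  show "a \<longrightarrow> b" if "(a, b) \<in> set_pmf pq" for a b
    using that by (auto simp: pq_def)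
qed

lemma rel_pmf_random_subset_mono:
  assumes "finite I" "0 \<le> p" "p \<le> q" "q \<le> 1"
  shows "rel_pmf (\<subseteq>) (random_subset I p) (random_subset I q)"
  using assms(1)
proof (induction I rule: finite_induct)
  case empty
  then show ?case by (simp add: random_subset_def)
next
  case (insert x I)
  show ?case
    unfolding random_subset_insert[OF insert.hyps]
    by (rule rel_pmf_bindI[OF rel_pmf_bernoulli[OF assms(2-4)]])
      (auto simp: pmf.rel_map split: if_splits intro!: pmf.rel_mono_strong[OF insert.IH])
qed

lemma prob_random_subset_mono:
  assumes "finite I" "0 \<le> p" "p \<le> q" "q \<le> 1" and "\<And>E E'. E \<subseteq> E' \<Longrightarrow> P E \<Longrightarrow> P E'"
  shows "measure_pmf.prob (random_subset I p) {E. P E} \<le> measure_pmf.prob (random_subset I q) {E. P E}"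
proof -
  have "measure_pmf.prob (random_subset I p) {E. P E} \<le>
      measure_pmf.prob (random_subset I q) {E'. \<exists>E\<in>{E. P E}. E \<subseteq> E'}"
    using rel_pmf_random_subset_mono[OF assms(1-4)] by (rule rel_pmf_measureD)
  also have "\<dots> \<le> measure_pmf.prob (random_subset I q) {E. P E}"
    using assms(5) by (intro measure_pmf.finite_measure_mono) auto
  finally show ?thesis .
qed

definition contained_count :: "('j \<Rightarrow> 'a set) \<Rightarrow> 'j set \<Rightarrow> 'a set \<Rightarrow> nat" where
  "contained_count A J E = card {j \<in> J. A j \<subseteq> E}"

lemma contained_count_sq:
  "(contained_count A J E)\<^sup>2 = contained_count (\<lambda>(i, j). A i \<union> A j) (J \<times> J) E"
proof -
  have "{x \<in> J \<times> J. (case x of (i, j) \<Rightarrow> A i \<union> A j) \<subseteq> E} = {j \<in> J. A j \<subseteq> E} \<times> {j \<in> J. A j \<subseteq> E}"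
    by auto
  then show ?thesis by (simp add: contained_count_def card_cartesian_product power2_eq_square)
qed

lemma expectation_contained_count:
  assumes "finite I" "finite J" "\<And>j. j \<in> J \<Longrightarrow> A j \<subseteq> I" "0 \<le> p" "p \<le> 1"
  shows "measure_pmf.expectation (random_subset I p) (\<lambda>E. real (contained_count A J E)) =
    (\<Sum>j\<in>J. p ^ card (A j))"
proof -
  have "real (contained_count A J E) = (\<Sum>j\<in>J. indicator {E. A j \<subseteq> E} E)" for E
    using assms(2) by (simp add: contained_count_def indicator_def sum.If_cases Int_def)
  then show ?thesis
    using assms by (simp add: integrable_random_subset prob_random_subset_superset)
qed

lemma prob_contained_count_ge:
  assumes "finite I" "finite J" "\<And>j. j \<in> J \<Longrightarrow> A j \<subseteq> I" "0 \<le> p" "p \<le> 1" "0 < a"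
  shows "measure_pmf.prob (random_subset I p) {E. a \<le> real (contained_count A J E)} \<le>
    (\<Sum>j\<in>J. p ^ card (A j)) / a"
  using integral_Markov_inequality_measure[of "measure_pmf (random_subset I p)"
      "\<lambda>E. real (contained_count A J E)" "{}" a] assms
  by (simp add: expectation_contained_count integrable_random_subset)

text \<open>Pairs of disjoint sets are independent, so they do not contribute to the variance.\<close>

lemma variance_contained_count_le:
  fixes p :: real
  assumes "finite I" "finite J" "\<And>j. j \<in> J \<Longrightarrow> A j \<subseteq> I" "0 \<le> p" "p \<le> 1"
  shows "measure_pmf.variance (random_subset I p) (\<lambda>E. real (contained_count A J E)) \<le>
    (\<Sum>(i, j) | i \<in> J \<and> j \<in> J \<and> A i \<inter> A j \<noteq> {}. p ^ card (A i \<union> A j))"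
proof -
  let ?M = "random_subset I p" and ?f = "\<lambda>E. real (contained_count A J E)"
  let ?O = "{(i, j). i \<in> J \<and> j \<in> J \<and> A i \<inter> A j \<noteq> {}}"
  have "measure_pmf.expectation ?M (\<lambda>E. (?f E)\<^sup>2) = (\<Sum>(i, j)\<in>J \<times> J. p ^ card (A i \<union> A j))"
    unfolding of_nat_power[symmetric] contained_count_sq
    using assms
    by (subst expectation_contained_count) (auto simp: case_prod_unfold dest: subsetD[OF assms(3)])
  also have "\<dots> = (\<Sum>(i, j)\<in>?O. p ^ card (A i \<union> A j)) +
      (\<Sum>(i, j)\<in>J \<times> J - ?O. p ^ card (A i \<union> A j))"
    using assms(2) by (subst sum.subset_diff[of ?O]) (auto simp: add.commute)
  also have "(\<Sum>(i, j)\<in>J \<times> J - ?O. p ^ card (A i \<union> A j)) =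
      (\<Sum>(i, j)\<in>J \<times> J - ?O. p ^ card (A i) * p ^ card (A j))"
  proof (intro sum.cong refl)
    fix x assume "x \<in> J \<times> J - ?O"
    then obtain i j where disjoint: "x = (i, j)" "i \<in> J" "j \<in> J" "A i \<inter> A j = {}" by auto
    then have "card (A i \<union> A j) = card (A i) + card (A j)"
      using assms(1,3) by (intro card_Un_disjoint) (auto intro: finite_subset)
    then show "(case x of (i, j) \<Rightarrow> p ^ card (A i \<union> A j)) =
        (case x of (i, j) \<Rightarrow> p ^ card (A i) * p ^ card (A j))"
      by (simp add: disjoint(1) power_add)
  qed
  also have "\<dots> \<le> (\<Sum>(i, j)\<in>J \<times> J. p ^ card (A i) * p ^ card (A j))"
    using assms(2,4) by (intro sum_mono2) auto
  also have "\<dots> = (\<Sum>j\<in>J. p ^ card (A j))\<^sup>2"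
    by (simp add: power2_eq_square sum_product sum.cartesian_product)
  finally show ?thesis
    using assms
    by (subst measure_pmf.variance_eq) (auto simp: integrable_random_subset expectation_contained_count)
qed

lemma prob_contained_count_le_half:
  fixes p :: real
  assumes "finite I" "finite J" "\<And>j. j \<in> J \<Longrightarrow> A j \<subseteq> I" "0 \<le> p" "p \<le> 1"
    and mean: "\<mu> = (\<Sum>j\<in>J. p ^ card (A j))" "0 < \<mu>"
  shows "measure_pmf.prob (random_subset I p) {E. real (contained_count A J E) \<le> \<mu> / 2} \<le>
    4 * (\<Sum>(i, j) | i \<in> J \<and> j \<in> J \<and> A i \<inter> A j \<noteq> {}. p ^ card (A i \<union> A j)) / \<mu>\<^sup>2"
    (is "_ \<le> 4 * ?\<Delta> / _")
proof -
  let ?M = "random_subset I p" and ?f = "\<lambda>E. real (contained_count A J E)"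
  have expectation: "measure_pmf.expectation ?M ?f = \<mu>"
    using assms by (simp add: expectation_contained_count)
  have "measure_pmf.prob ?M {E. ?f E \<le> \<mu> / 2} \<le> measure_pmf.prob ?M {E. \<mu> / 2 \<le> \<bar>?f E - \<mu>\<bar>}"
    using mean(2) by (intro measure_pmf.finite_measure_mono) auto
  also have "\<dots> \<le> measure_pmf.variance ?M ?f / (\<mu> / 2)\<^sup>2"
    using measure_pmf.Chebyshev_inequality[of ?f ?M "\<mu> / 2"] assms(1) mean(2) expectation
    by (simp add: integrable_random_subset)
  also have "\<dots> \<le> ?\<Delta> / (\<mu> / 2)\<^sup>2"
    using variance_contained_count_le[OF assms(1-3)] assms(4,5) by (intro divide_right_mono) auto
  finally show ?thesis by (simp add: power_divide mult.commute)
qed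

section \<open>Counting triangles\<close>

lemma binomial_le_power: "n choose k \<le> n ^ k"
  by (cases "k \<le> n") (auto simp: not_le binomial_eq_0 intro: binomial_le_pow)

definition triangles :: "nat \<Rightarrow> 'a set \<Rightarrow> 'a set set set" where
  "triangles k V = {T. T \<subseteq> nsets V k \<and> triangle k T}"

lemma finite_triangles: "finite V \<Longrightarrow> finite (triangles k V)"
  by (rule finite_subset[of _ "Pow (nsets V k)"]) (auto simp: triangles_def finite_imp_finite_nsets)

lemma card_triangles_spanning_le:
  assumes "finite J" "\<And>T. T \<in> \<T> \<Longrightarrow> triangle k T \<and> \<Union>T \<in> g ` J"
  shows "card \<T> \<le> card J * (Suc k choose 3)"
proof -
  let ?J = "{j \<in> J. card (g j) = Suc k}"
  have fin: "finite (nsets (g j) 3)" if "j \<in> ?J" for j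
    using that by (auto intro!: finite_imp_finite_nsets intro: card_ge_0_finite)
  have "\<T> \<subseteq> (\<Union>j\<in>?J. facets (g j) ` nsets (g j) 3)"
  proof
    fix T assume "T \<in> \<T>"
    then obtain j where j: "triangle k T" "j \<in> J" "\<Union>T = g j" using assms(2) by blast
    obtain A where A: "A \<subseteq> \<Union>T" "card A = 3" "T = facets (\<Union>T) A"
      using triangle_eq_facets[OF j(1)] .
    have "A \<in> nsets (g j) 3"
      using A(1,2) unfolding j(3) by (auto simp: nsets_def intro: card_ge_0_finite)
    moreover have "j \<in> ?J" using j triangleD(4)[OF j(1)] by simp
    ultimately show "T \<in> (\<Union>j\<in>?J. facets (g j) ` nsets (g j) 3)" using A(3) unfolding j(3) by blast
  qed
  then have "card \<T> \<le> card (\<Union>j\<in>?J. facets (g j) ` nsets (g j) 3)"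
    using assms(1) fin by (intro card_mono) auto
  also have "\<dots> \<le> (\<Sum>j\<in>?J. card (facets (g j) ` nsets (g j) 3))"
    using assms(1) by (intro card_UN_le) simp
  also have "\<dots> \<le> (\<Sum>j\<in>?J. Suc k choose 3)"
  proof (intro sum_mono)
    fix j assume j: "j \<in> ?J"
    then show "card (facets (g j) ` nsets (g j) 3) \<le> Suc k choose 3"
      using card_image_le[OF fin[OF j], of "facets (g j)"] by simp
  qed
  also have "\<dots> \<le> card J * (Suc k choose 3)"
    using assms(1) by (simp add: card_mono)
  finally show ?thesis .
qed

lemma card_triangles_le:
  assumes "finite V"
  shows "card (triangles k V) \<le> card V ^ Suc k * (Suc k choose 3)"
proof -
  have "card (triangles k V) \<le> card (nsets V (Suc k)) * (Suc k choose 3)"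
  proof (rule card_triangles_spanning_le[where g = id])
    fix T assume "T \<in> triangles k V"
    then show "triangle k T \<and> \<Union>T \<in> id ` nsets V (Suc k)"
      using triangleD(3,4)[of k T] by (auto simp: triangles_def nsets_def)
  qed (use assms in \<open>rule finite_imp_finite_nsets\<close>)
  also have "card (nsets V (Suc k)) \<le> card V ^ Suc k"
    unfolding card_nsets by (rule binomial_le_power)
  finally show ?thesis by simp
qed

lemma card_triangles_over_le:
  assumes "finite V" "card S = k - 1" "1 \<le> k"
  shows "card {T \<in> triangles k V. \<exists>e\<in>T. S \<subseteq> e} \<le> card V ^ 2 * (Suc k choose 3)"
proof -
  have "card {T \<in> triangles k V. \<exists>e\<in>T. S \<subseteq> e} \<le> card (V \<times> V) * (Suc k choose 3)"
  proof (rule card_triangles_spanning_le[where g = "\<lambda>(x, y). S \<union> {x, y}"])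
    fix T assume "T \<in> {T \<in> triangles k V. \<exists>e\<in>T. S \<subseteq> e}"
    then obtain e where T: "triangle k T" "T \<subseteq> nsets V k" "e \<in> T" "S \<subseteq> e"
      by (auto simp: triangles_def)
    then have edge: "finite e" "card e = k" "e \<subseteq> V" by (auto simp: nsets_def)
    obtain y where Union_eq: "y \<in> \<Union>T" "\<Union>T = insert y e"
      using triangle_Union_insert[OF T(1,3)] by blast
    have "card (e - S) = 1"
      using edge T(4) assms(2,3) by (simp add: card_Diff_subset finite_subset)
    then obtain x where diff_eq: "e - S = {x}" by (auto simp: card_1_singleton_iff)
    have "\<Union>T = S \<union> {x, y}" using Union_eq(2) diff_eq T(4) by blast
    moreover have "x \<in> V" "y \<in> V" using diff_eq Union_eq(1) edge(3) T(2) by (auto simp: nsets_def)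
    ultimately show "triangle k T \<and> \<Union>T \<in> (\<lambda>(x, y). S \<union> {x, y}) ` (V \<times> V)"
      using T(1) by auto
  qed (use assms(1) in simp)
  then show ?thesis by (simp add: card_cartesian_product power2_eq_square)
qed

lemma card_triangles_meeting_le:
  assumes "finite V" "finite E"
  shows "card {T \<in> triangles k V. T \<inter> E \<noteq> {}} \<le> card E * card V * (Suc k choose 3)"
proof -
  have "card {T \<in> triangles k V. T \<inter> E \<noteq> {}} \<le> card (E \<times> V) * (Suc k choose 3)"
  proof (rule card_triangles_spanning_le[where g = "\<lambda>(e, y). insert y e"])
    fix T assume "T \<in> {T \<in> triangles k V. T \<inter> E \<noteq> {}}"
    then obtain e where T: "triangle k T" "T \<subseteq> nsets V k" "e \<in> T" "e \<in> E"
      by (auto simp: triangles_def)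
    obtain y where "y \<in> \<Union>T" "\<Union>T = insert y e" using triangle_Union_insert[OF T(1,3)] by blast
    moreover from this(1) have "y \<in> V" using T(2) by (auto simp: nsets_def)
    ultimately show "triangle k T \<and> \<Union>T \<in> (\<lambda>(e, y). insert y e) ` (E \<times> V)"
      using T(1,4) by auto
  qed (use assms in simp)
  then show ?thesis by (simp add: card_cartesian_product)
qed

lemma card_triangles_meeting_twice_le:
  assumes "finite E"
  shows "card {T \<in> triangles k V. card (T \<inter> E) = 2} \<le> card E ^ 2 * (Suc k choose 3)"
proof -
  have "card {T \<in> triangles k V. card (T \<inter> E) = 2} \<le> card (E \<times> E) * (Suc k choose 3)"
  proof (rule card_triangles_spanning_le[where g = "\<lambda>(e, f). e \<union> f"])
    fix T assume T: "T \<in> {T \<in> triangles k V. card (T \<inter> E) = 2}"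
    then obtain e f where Int_eq: "T \<inter> E = {e, f}" "e \<noteq> f" by (auto simp: card_2_iff)
    moreover from this have "\<Union>T = e \<union> f"
      using T by (intro triangle_Union_Un[of k]) (auto simp: triangles_def)
    ultimately show "triangle k T \<and> \<Union>T \<in> (\<lambda>(e, f). e \<union> f) ` (E \<times> E)"
      using T by (auto simp: triangles_def)
  qed (use assms in simp)
  then show ?thesis by (simp add: card_cartesian_product power2_eq_square)
qed

section \<open>Exploration of stuck sets\<close>

definition extensions :: "nat \<Rightarrow> 'a set \<Rightarrow> 'a set \<Rightarrow> 'a set set set" where
  "extensions k V S = {T \<in> triangles k V. \<exists>e\<in>T. S \<subseteq> e}"

definition substep :: "nat \<Rightarrow> 'a set \<Rightarrow> 'a set \<Rightarrow> 'a set set \<Rightarrow> 'a set set set" where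
  "substep k V S E = insert E ((\<union>) E ` extensions k V S)"

primrec substeps :: "nat \<Rightarrow> 'a set \<Rightarrow> 'a set \<Rightarrow> nat \<Rightarrow> 'a set set \<Rightarrow> 'a set set set" where
  "substeps k V S 0 E = {E}"
| "substeps k V S (Suc i) E = (\<Union>E'\<in>substep k V S E. substeps k V S i E')"

text \<open>
  In a state \<open>(D, E)\<close>, the edges \<open>E\<close> have been found and those in \<open>D\<close> are known to contain a heavy
  set. Processing an edge of \<open>E - D\<close> guesses its heavy set and adds at most \<open>t\<close> triangles over it.
\<close>

definition process_edge ::
  "nat \<Rightarrow> 'a set \<Rightarrow> nat \<Rightarrow> 'a set set \<times> 'a set set \<Rightarrow> ('a set set \<times> 'a set set) set" where
  "process_edge k V t = (\<lambda>(D, E).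
     if D = E then {(D, E)}
     else let e = (SOME e. e \<in> E - D)
       in \<Union>S\<in>nsets e (k - 1). Pair (insert e D) ` substeps k V S t E)"

primrec explore :: "nat \<Rightarrow> 'a set \<Rightarrow> nat \<Rightarrow> nat \<Rightarrow> ('a set set \<times> 'a set set) set" where
  "explore k V t 0 = Pair {} ` triangles k V"
| "explore k V t (Suc j) = (\<Union>s\<in>explore k V t j. process_edge k V t s)"

lemma finite_extensions: "finite V \<Longrightarrow> finite (extensions k V S)"
  by (simp add: extensions_def finite_triangles)

lemma finite_substep: "finite V \<Longrightarrow> finite (substep k V S E)"
  by (simp add: substep_def finite_extensions)

lemma finite_substeps: "finite V \<Longrightarrow> finite (substeps k V S i E)"
  by (induction i arbitrary: E) (simp_all add: finite_substep)

lemma substep_bounds: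
  assumes "E' \<in> substep k V S E" "E \<subseteq> nsets V k"
  shows "E \<subseteq> E' \<and> E' \<subseteq> nsets V k \<and> card E' \<le> card E + 3"
proof (cases "E' = E")
  case False
  then obtain T where T: "T \<in> triangles k V" "E' = E \<union> T"
    using assms(1) by (auto simp: substep_def extensions_def)
  then have "card E' \<le> card E + 3"
    using card_Un_le[of E T] triangleD(2)[of k T] by (simp add: triangles_def)
  then show ?thesis using T assms(2) by (auto simp: triangles_def)
qed (use assms in simp)

lemma substeps_bounds:
  assumes "E' \<in> substeps k V S i E" "E \<subseteq> nsets V k"
  shows "E \<subseteq> E' \<and> E' \<subseteq> nsets V k \<and> card E' \<le> card E + 3 * i"
  using assms
proof (induction i arbitrary: E)
  case (Suc i)
  then obtain E1 where steps: "E1 \<in> substep k V S E" "E' \<in> substeps k V S i E1" by auto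
  note first = substep_bounds[OF steps(1) Suc.prems(2)]
  with Suc.IH[OF steps(2)] show ?case by auto
qed simp

lemma process_edge_unprocessed:
  assumes "D \<subset> E"
  obtains e where "e \<in> E - D"
    "process_edge k V t (D, E) = (\<Union>S\<in>nsets e (k - 1). Pair (insert e D) ` substeps k V S t E)"
proof
  show "(SOME e. e \<in> E - D) \<in> E - D" by (rule someI_ex) (use assms in blast)
  have "D \<noteq> E" using assms by blast
  then show "process_edge k V t (D, E) =
      (\<Union>S\<in>nsets (SOME e. e \<in> E - D) (k - 1). Pair (insert (SOME e. e \<in> E - D) D) ` substeps k V S t E)"
    unfolding process_edge_def Let_def by (simp only: prod.case if_False)
qed

lemma process_edge_done [simp]: "process_edge k V t (E, E) = {(E, E)}"
  by (simp add: process_edge_def)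

lemma explore_bounds:
  assumes "finite V" "(D, E) \<in> explore k V t j"
  shows "D \<subseteq> E \<and> E \<subseteq> nsets V k \<and> card E \<le> 3 + 3 * t * j \<and> (D = E \<or> card D = j)"
  using assms(2)
proof (induction j arbitrary: D E)
  case 0
  then show ?case using triangleD(2)[of k E] by (auto simp: triangles_def)
next
  case (Suc j)
  then obtain D0 E0
    where previous: "(D0, E0) \<in> explore k V t j" "(D, E) \<in> process_edge k V t (D0, E0)"
    by auto
  note IH = Suc.IH[OF previous(1)]
  then have "finite D0" using finite_imp_finite_nsets[OF assms(1), of k] by (meson finite_subset)
  show ?case
  proof (cases "D0 = E0")
    case True
    then show ?thesis using previous(2) IH by simp
  next
    case False
    then have "D0 \<subset> E0" using IH by blast
    then obtain e where "e \<in> E0 - D0"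
      "process_edge k V t (D0, E0) = (\<Union>S\<in>nsets e (k - 1). Pair (insert e D0) ` substeps k V S t E0)"
      by (rule process_edge_unprocessed)
    then obtain S where new: "e \<in> E0 - D0" "D = insert e D0" "E \<in> substeps k V S t E0"
      using previous(2) by auto
    then have "card D = Suc j" using IH False \<open>finite D0\<close> by simp
    moreover have "E0 \<subseteq> E" "E \<subseteq> nsets V k" "card E \<le> card E0 + 3 * t"
      using substeps_bounds[OF new(3)] IH by simp_all
    ultimately show ?thesis using new IH by auto
  qed
qed

lemma finite_process_edge:
  assumes "finite V" "D \<subseteq> E" "E \<subseteq> nsets V k"
  shows "finite (process_edge k V t (D, E))"
proof (cases "D = E")
  case False
  then have "D \<subset> E" using assms(2) by blast
  then obtain e where e: "e \<in> E - D"
    "process_edge k V t (D, E) = (\<Union>S\<in>nsets e (k - 1). Pair (insert e D) ` substeps k V S t E)"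
    by (rule process_edge_unprocessed)
  moreover have "finite e" using e(1) assms(3) by (auto simp: nsets_def)
  ultimately show ?thesis using assms(1) by (simp add: finite_substeps finite_imp_finite_nsets)
qed simp

lemma finite_explore:
  assumes "finite V"
  shows "finite (explore k V t j)"
proof (induction j)
  case (Suc j)
  then show ?case
    using finite_process_edge[OF assms] explore_bounds[OF assms] by auto
qed (simp add: finite_triangles assms)

lemma triangle_covered_Un_triangle:
  assumes "triangle_covered k E" "triangle k T"
  shows "triangle_covered k (E \<union> T)"
  unfolding triangle_covered_def
proof
  fix e assume "e \<in> E \<union> T"
  then consider (old) "e \<in> E" | (new) "e \<in> T" by blast
  then show "\<exists>T'\<subseteq>E \<union> T. e \<in> T' \<and> triangle k T'"
  proof cases
    case old
    then show ?thesis using assms(1) unfolding triangle_covered_def by (meson le_supI1)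
  next
    case new
    then show ?thesis using assms(2) by blast
  qed
qed

lemma substeps_absorb:
  assumes "finite V" "E \<subseteq> nsets V k" "triangle_covered k E"
    and A_sub: "finite A" "A \<subseteq> {f \<in> E. S \<subseteq> f}"
    and "E0 \<subseteq> E" "triangle_covered k E0"
  shows "\<exists>E'\<in>substeps k V S (card A) E0. A \<subseteq> E' \<and> E' \<subseteq> E \<and> triangle_covered k E'"
  using A_sub assms(6,7)
proof (induction A arbitrary: E0 rule: finite_induct)
  case (insert f A)
  then have f: "f \<in> E" "S \<subseteq> f" by auto
  obtain T where T: "f \<in> T" "T \<subseteq> E" "triangle k T"
    using assms(3) f(1) by (auto simp: triangle_covered_def)
  then have "T \<in> extensions k V S" using f(2) assms(2) by (auto simp: extensions_def triangles_def)
  then have step: "E0 \<union> T \<in> substep k V S E0" unfolding substep_def by blast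
  have "triangle_covered k (E0 \<union> T)"
    using insert.prems(3) T(3) by (rule triangle_covered_Un_triangle)
  moreover have "E0 \<union> T \<subseteq> E" using insert.prems(2) T(2) by blast
  moreover have "A \<subseteq> {f \<in> E. S \<subseteq> f}" using insert.prems(1) by blast
  ultimately have "\<exists>E'\<in>substeps k V S (card A) (E0 \<union> T). A \<subseteq> E' \<and> E' \<subseteq> E \<and> triangle_covered k E'"
    by (intro insert.IH)
  then obtain E' where
    E': "E' \<in> substeps k V S (card A) (E0 \<union> T)" "A \<subseteq> E'" "E' \<subseteq> E" "triangle_covered k E'"
    by blast
  have "E0 \<union> T \<subseteq> E'"
    using substeps_bounds[OF E'(1)] \<open>E0 \<union> T \<subseteq> E\<close> assms(2) by blast
  then have "insert f A \<subseteq> E'" using T(1) E'(2) by blast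
  moreover have "card (insert f A) = Suc (card A)" using insert.hyps by simp
  then have "E' \<in> substeps k V S (card (insert f A)) E0"
    using E'(1) step by (simp only: substeps.simps) blast
  ultimately show ?case using E'(3,4) by blast
qed simp

definition consistent_state ::
  "nat \<Rightarrow> nat \<Rightarrow> 'a set set \<Rightarrow> 'a set set \<times> 'a set set \<Rightarrow> bool" where
  "consistent_state k t E = (\<lambda>(D, E'). E' \<subseteq> E \<and> E' \<noteq> {} \<and> triangle_covered k E' \<and>
     (\<forall>e\<in>D. \<exists>S\<in>heavy_sets k t E'. S \<subseteq> e))"

lemma process_edge_consistent:
  assumes stuck: "stuck k t E" and E_sub: "E \<subseteq> nsets V k" and fin_V: "finite V"
    and consistent: "consistent_state k t E (D, E0)" and D_sub: "D \<subset> E0"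
  shows "\<exists>s\<in>process_edge k V t (D, E0). consistent_state k t E s"
proof -
  have E0: "E0 \<subseteq> E" "E0 \<noteq> {}" "triangle_covered k E0"
    and heavy: "\<And>e. e \<in> D \<Longrightarrow> \<exists>S\<in>heavy_sets k t E0. S \<subseteq> e"
    using consistent by (auto simp: consistent_state_def)
  obtain e where e: "e \<in> E0 - D" and step:
    "process_edge k V t (D, E0) = (\<Union>S\<in>nsets e (k - 1). Pair (insert e D) ` substeps k V S t E0)"
    by (rule process_edge_unprocessed[OF D_sub])
  have "e \<in> E" using e E0(1) by blast
  then obtain S where S: "S \<in> heavy_sets k t E" "S \<subseteq> e" using stuck by (auto simp: stuck_def)
  then have "t \<le> card {f \<in> E. S \<subseteq> f}" by (simp add: heavy_sets_def codegree_def)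
  then obtain A where A: "A \<subseteq> {f \<in> E. S \<subseteq> f}" "card A = t" "finite A"
    by (rule obtain_subset_with_card_n)
  obtain E' where E': "E' \<in> substeps k V S t E0" "A \<subseteq> E'" "E' \<subseteq> E" "triangle_covered k E'"
    using substeps_absorb[OF fin_V E_sub _ A(3,1) E0(1,3)] stuck A(2) by (auto simp: stuck_def)
  have fin_E': "finite E'"
    using E'(3) E_sub finite_imp_finite_nsets[OF fin_V] finite_subset by metis
  have mono: "E0 \<subseteq> E'" using substeps_bounds[OF E'(1)] E0(1) E_sub by blast
  have "S \<in> nsets e (k - 1)"
    using S \<open>e \<in> E\<close> E_sub by (auto simp: nsets_def heavy_sets_def intro: finite_subset)
  then have "(insert e D, E') \<in> process_edge k V t (D, E0)" using E'(1) unfolding step by blast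
  moreover have "S \<in> heavy_sets k t E'"
    using S(1) A fin_E' E'(2) card_mono[of "{f \<in> E'. S \<subseteq> f}" A]
    by (auto simp: heavy_sets_def codegree_def)
  then have "\<exists>S\<in>heavy_sets k t E'. S \<subseteq> f" if "f \<in> insert e D" for f
    using that heavy[of f] heavy_sets_mono[OF mono fin_E', of k t] S(2) by blast
  then have "consistent_state k t E (insert e D, E')"
    using E'(3,4) mono E0(2) by (auto simp: consistent_state_def)
  ultimately show ?thesis by blast
qed

lemma explore_consistent:
  assumes stuck: "stuck k t E" and E_sub: "E \<subseteq> nsets V k" and fin_V: "finite V"
  shows "\<exists>s\<in>explore k V t j. consistent_state k t E s"
proof (induction j)
  case 0
  obtain e T where "T \<subseteq> E" "e \<in> T" "triangle k T"
    using stuck unfolding stuck_def triangle_covered_def by blast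
  moreover from this have "T \<in> triangles k V" using E_sub by (auto simp: triangles_def)
  ultimately show ?case
    by (intro bexI[of _ "({}, T)"]) (auto simp: consistent_state_def triangle_covered_def)
next
  case (Suc j)
  then obtain D E0 where found: "(D, E0) \<in> explore k V t j"
    and consistent: "consistent_state k t E (D, E0)"
    by auto
  have "\<exists>s\<in>process_edge k V t (D, E0). consistent_state k t E s"
  proof (cases "D = E0")
    case False
    then have "D \<subset> E0" using explore_bounds[OF fin_V found] by blast
    then show ?thesis by (rule process_edge_consistent[OF assms consistent])
  qed (use consistent in simp)
  then show ?case using found by auto
qed

lemma stuck_imp_small_or_large:
  assumes "stuck k t E" "E \<subseteq> nsets V k" "finite V"
  shows "(\<exists>E'\<subseteq>E. stuck k t E' \<and> card E' \<le> M) \<or> (\<exists>(D, E')\<in>explore k V t M. M < card E' \<and> E' \<subseteq> E)"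
proof -
  obtain D E' where E': "(D, E') \<in> explore k V t M" "E' \<subseteq> E" "E' \<noteq> {}" "triangle_covered k E'"
    and heavy: "\<forall>e\<in>D. \<exists>S\<in>heavy_sets k t E'. S \<subseteq> e"
    using explore_consistent[OF assms, of M] by (auto simp: consistent_state_def)
  show ?thesis
  proof (cases "M < card E'")
    case False
    have bounds: "D \<subseteq> E'" "E' \<subseteq> nsets V k" "D = E' \<or> card D = M"
      using explore_bounds[OF assms(3) E'(1)] by auto
    moreover have "finite E'"
      using bounds(2) finite_imp_finite_nsets[OF assms(3)] finite_subset by blast
    ultimately have "D = E'" using False card_subset_eq[of E' D] card_mono[of E' D] by auto
    then have "stuck k t E'" using E'(3,4) heavy by (simp add: stuck_def)
    then show ?thesis using E'(2) False by auto
  qed (use E' in blast)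
qed

section \<open>Weight of the exploration\<close>

lemma sum_UN_le_mult:
  fixes w :: "'b \<Rightarrow> real"
  assumes "finite I" "\<And>i. i \<in> I \<Longrightarrow> finite (A i)" "\<And>y. 0 \<le> w y"
    and "\<And>i. i \<in> I \<Longrightarrow> sum w (A i) \<le> c * v i"
  shows "sum w (\<Union>i\<in>I. A i) \<le> c * sum v I"
  using assms(1,2,4)
proof (induction I rule: finite_induct)
  case (insert i I)
  have "sum w (A i \<union> (\<Union>i\<in>I. A i)) \<le> sum w (A i) + sum w (\<Union>i\<in>I. A i)"
    using insert.hyps insert.prems(1) assms(3) by (subst sum_Un) (auto intro!: sum_nonneg)
  also have "\<dots> \<le> c * v i + c * sum v I"
    using insert by (intro add_mono) auto
  finally show ?case using insert.hyps by (simp add: distrib_left)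
qed simp

text \<open>
  With \<open>n\<close> points available, a triangle over a given \<open>(k - 1)\<close>-set that has \<open>0\<close>, \<open>1\<close> or \<open>2\<close> of its
  edges among \<open>l\<close> given ones has at most \<open>n\<^sup>2\<close>, \<open>l n\<close> or \<open>l\<^sup>2\<close> possible vertex sets.
\<close>

definition branching_factor :: "nat \<Rightarrow> real \<Rightarrow> real \<Rightarrow> real \<Rightarrow> real" where
  "branching_factor k n l x = 1 + real (Suc k choose 3) * (n\<^sup>2 * x ^ 3 + l * n * x\<^sup>2 + l\<^sup>2 * x)"

lemma branching_factor_ge_1: "0 \<le> n \<Longrightarrow> 0 \<le> l \<Longrightarrow> 0 \<le> x \<Longrightarrow> 1 \<le> branching_factor k n l x"
  by (simp add: branching_factor_def)

lemma branching_factor_mono: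
  assumes "0 \<le> n" "0 \<le> l" "l \<le> l'" "0 \<le> x" "x \<le> x'"
  shows "branching_factor k n l x \<le> branching_factor k n l' x'"
  unfolding branching_factor_def using assms
  by (intro add_mono mult_mono power_mono order_refl) auto

lemma card_extensions_le:
  assumes fin_V: "finite V" and fin_E: "finite E" and card_S: "card S = k - 1" "1 \<le> k"
  shows "card {T \<in> extensions k V S. card (T - E) = 3} \<le> card V ^ 2 * (Suc k choose 3)"
    and "card {T \<in> extensions k V S. card (T - E) = 2} \<le> card E * card V * (Suc k choose 3)"
    and "card {T \<in> extensions k V S. card (T - E) = 1} \<le> card E ^ 2 * (Suc k choose 3)"
proof -
  have split: "card (T \<inter> E) + card (T - E) = 3" if "T \<in> extensions k V S" for T
  proof -
    have "triangle k T" using that by (simp add: extensions_def triangles_def)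
    then show ?thesis using triangleD(1,2)[of k T] card_Int_Diff[of T E] by simp
  qed
  have "card {T \<in> extensions k V S. card (T - E) = 3} \<le> card (extensions k V S)"
    using fin_V by (intro card_mono) (auto simp: finite_extensions)
  also have "\<dots> \<le> card V ^ 2 * (Suc k choose 3)"
    unfolding extensions_def by (rule card_triangles_over_le[OF fin_V card_S])
  finally show "card {T \<in> extensions k V S. card (T - E) = 3} \<le> card V ^ 2 * (Suc k choose 3)" .
  have "card {T \<in> extensions k V S. card (T - E) = 2} \<le> card {T \<in> triangles k V. T \<inter> E \<noteq> {}}"
  proof (rule card_mono)
    show "{T \<in> extensions k V S. card (T - E) = 2} \<subseteq> {T \<in> triangles k V. T \<inter> E \<noteq> {}}"
    proof
      fix T assume T: "T \<in> {T \<in> extensions k V S. card (T - E) = 2}"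
      then have "card (T \<inter> E) \<noteq> 0" using split[of T] by simp
      then have "T \<inter> E \<noteq> {}" by force
      then show "T \<in> {T \<in> triangles k V. T \<inter> E \<noteq> {}}" using T by (simp add: extensions_def)
    qed
  qed (simp add: finite_triangles fin_V)
  also have "\<dots> \<le> card E * card V * (Suc k choose 3)"
    by (rule card_triangles_meeting_le[OF fin_V fin_E])
  finally show "card {T \<in> extensions k V S. card (T - E) = 2} \<le> card E * card V * (Suc k choose 3)" .
  have "card {T \<in> extensions k V S. card (T - E) = 1} \<le> card {T \<in> triangles k V. card (T \<inter> E) = 2}"
  proof (rule card_mono)
    show "{T \<in> extensions k V S. card (T - E) = 1} \<subseteq> {T \<in> triangles k V. card (T \<inter> E) = 2}"
    proof
      fix T assume T: "T \<in> {T \<in> extensions k V S. card (T - E) = 1}"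
      then have "card (T \<inter> E) = 2" using split[of T] by simp
      then show "T \<in> {T \<in> triangles k V. card (T \<inter> E) = 2}" using T by (simp add: extensions_def)
    qed
  qed (simp add: finite_triangles fin_V)
  also have "\<dots> \<le> card E ^ 2 * (Suc k choose 3)" by (rule card_triangles_meeting_twice_le[OF fin_E])
  finally show "card {T \<in> extensions k V S. card (T - E) = 1} \<le> card E ^ 2 * (Suc k choose 3)" .
qed

lemma substep_subset_extensions:
  assumes "finite V"
  shows "substep k V S E \<subseteq>
    insert E (\<Union>i\<in>{1, 2, 3}. (\<union>) E ` {T \<in> extensions k V S. card (T - E) = i})"
proof
  fix E' assume E': "E' \<in> substep k V S E"
  show "E' \<in> insert E (\<Union>i\<in>{1, 2, 3}. (\<union>) E ` {T \<in> extensions k V S. card (T - E) = i})"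
  proof (cases "E' = E")
    case False
    then obtain T where T: "T \<in> extensions k V S" "E' = E \<union> T"
      using E' by (auto simp: substep_def)
    then have "finite T" "card T = 3"
      using triangleD(1,2) by (auto simp: extensions_def triangles_def)
    then have "card (T - E) \<le> 3" "card (T - E) \<noteq> 0"
      using card_mono[of T "T - E"] False T(2) by auto
    then have "card (T - E) \<in> {1, 2, 3}" by auto
    then show ?thesis using T by blast
  qed simp
qed

lemma sum_extensions_le:
  fixes x :: real
  assumes fin_V: "finite V" and fin_E: "finite E" and x_nonneg: "0 \<le> x"
  shows "(\<Sum>E'\<in>(\<union>) E ` {T \<in> extensions k V S. card (T - E) = i}. x ^ card E') \<le>
    x ^ card E * (card {T \<in> extensions k V S. card (T - E) = i} * x ^ i)"
proof -
  let ?T = "{T \<in> extensions k V S. card (T - E) = i}"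
  have "finite ?T" by (simp add: finite_extensions fin_V)
  then have "(\<Sum>E'\<in>(\<union>) E ` ?T. x ^ card E') \<le> (\<Sum>T\<in>?T. x ^ card (E \<union> T))"
    using sum_image_le[of ?T "\<lambda>E'. x ^ card E'" "(\<union>) E"] x_nonneg by (simp add: o_def)
  also have "\<dots> = (\<Sum>T\<in>?T. x ^ (card E + i))"
  proof (intro sum.cong refl)
    fix T assume T: "T \<in> ?T"
    then have "finite T" using triangleD(1) by (auto simp: extensions_def triangles_def)
    then have "card (E \<union> (T - E)) = card E + card (T - E)"
      using fin_E by (intro card_Un_disjoint) auto
    then show "x ^ card (E \<union> T) = x ^ (card E + i)" using T by simp
  qed
  also have "\<dots> = x ^ card E * (card ?T * x ^ i)" by (simp add: power_add)
  finally show ?thesis .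
qed

lemma sum_substep_le:
  fixes x :: real and l :: nat
  assumes fin_V: "finite V" and E_bounds: "finite E" "card E \<le> l"
    and card_S: "card S = k - 1" "1 \<le> k" and x_nonneg: "0 \<le> x"
  shows "(\<Sum>E'\<in>substep k V S E. x ^ card E') \<le> branching_factor k (card V) l x * x ^ card E"
proof -
  let ?K = "real (Suc k choose 3)" and ?n = "real (card V)"
  let ?T = "\<lambda>i. {T \<in> extensions k V S. card (T - E) = i}"
  let ?U = "\<Union>i\<in>{1, 2, 3}. (\<union>) E ` ?T i"
  have fin_T: "finite (?T i)" for i by (simp add: finite_extensions fin_V)
  have "card (?T 2) \<le> l * card V * (Suc k choose 3)"
    by (rule order_trans[OF card_extensions_le(2)[OF fin_V E_bounds(1) card_S]])
      (intro mult_le_mono1 E_bounds(2))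
  moreover have "card (?T 1) \<le> l ^ 2 * (Suc k choose 3)"
    by (rule order_trans[OF card_extensions_le(3)[OF fin_V E_bounds(1) card_S]])
      (intro mult_le_mono1 power_mono E_bounds(2) le0)
  ultimately have card_T: "real (card (?T 3)) \<le> ?n\<^sup>2 * ?K" "real (card (?T 2)) \<le> l * ?n * ?K"
    "real (card (?T 1)) \<le> l\<^sup>2 * ?K"
    using card_extensions_le(1)[OF fin_V E_bounds(1) card_S]
    unfolding of_nat_power[symmetric] of_nat_mult[symmetric] of_nat_le_iff by simp_all
  have "(\<Sum>E'\<in>substep k V S E. x ^ card E') \<le> (\<Sum>E'\<in>insert E ?U. x ^ card E')"
    using substep_subset_extensions[OF fin_V] x_nonneg fin_T by (intro sum_mono2) auto
  also have "\<dots> \<le> x ^ card E + (\<Sum>E'\<in>?U. x ^ card E')"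
    using fin_T x_nonneg by (simp add: sum.insert_if)
  also have "(\<Sum>E'\<in>?U. x ^ card E') \<le> x ^ card E * (\<Sum>i\<in>{1, 2, 3}. card (?T i) * x ^ i)"
    using fin_T x_nonneg by (intro sum_UN_le_mult sum_extensions_le fin_V E_bounds(1)) auto
  also have "(\<Sum>i\<in>{1, 2, 3}. card (?T i) * x ^ i) =
      card (?T 1) * x + card (?T 2) * x\<^sup>2 + card (?T 3) * x ^ 3"
    by simp
  also have "x ^ card E * \<dots> \<le> x ^ card E * (l\<^sup>2 * ?K * x + l * ?n * ?K * x\<^sup>2 + ?n\<^sup>2 * ?K * x ^ 3)"
    using card_T x_nonneg by (intro mult_left_mono add_mono mult_right_mono) auto
  finally show ?thesis by (simp add: branching_factor_def algebra_simps)
qed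

lemma sum_substeps_le:
  fixes x :: real and l :: nat
  assumes fin_V: "finite V" and E_bounds: "E \<subseteq> nsets V k" "card E + 3 * i \<le> l"
    and card_S: "card S = k - 1" "1 \<le> k" and x_nonneg: "0 \<le> x"
  shows "(\<Sum>E'\<in>substeps k V S i E. x ^ card E') \<le> branching_factor k (card V) l x ^ i * x ^ card E"
  using E_bounds
proof (induction i arbitrary: E)
  case (Suc i)
  let ?b = "branching_factor k (card V) l x"
  have power_nonneg: "0 \<le> ?b ^ i" using branching_factor_ge_1[of "card V" l x k] x_nonneg by simp
  have fin_E: "finite E"
    using finite_imp_finite_nsets[OF fin_V] Suc.prems(1) by (rule finite_subset[rotated])
  have "(\<Sum>E'\<in>substeps k V S (Suc i) E. x ^ card E') \<le> ?b ^ i * (\<Sum>E'\<in>substep k V S E. x ^ card E')"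
    unfolding substeps.simps
  proof (rule sum_UN_le_mult)
    fix E' assume "E' \<in> substep k V S E"
    from substep_bounds[OF this Suc.prems(1)] Suc.prems(2)
    show "(\<Sum>E'\<in>substeps k V S i E'. x ^ card E') \<le> ?b ^ i * x ^ card E'"
      by (intro Suc.IH) auto
  qed (use fin_V x_nonneg in \<open>simp_all add: finite_substep finite_substeps\<close>)
  also have "\<dots> \<le> ?b ^ i * (?b * x ^ card E)"
    using power_nonneg fin_V fin_E Suc.prems(2) card_S x_nonneg
    by (intro mult_left_mono sum_substep_le) auto
  finally show ?case by (simp only: power_Suc2 mult.assoc)
qed simp

lemma sum_process_edge_le:
  fixes x :: real and l :: nat
  assumes fin_V: "finite V" and state: "D \<subseteq> E" "E \<subseteq> nsets V k" "card E + 3 * t \<le> l"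
    and k_pos: "1 \<le> k" and x_nonneg: "0 \<le> x"
  shows "(\<Sum>(D', E')\<in>process_edge k V t (D, E). x ^ card E') \<le>
    k * branching_factor k (card V) l x ^ t * x ^ card E"
proof (cases "D = E")
  case True
  have "1 * 1 \<le> real k * branching_factor k (card V) l x ^ t"
    using k_pos x_nonneg branching_factor_ge_1 by (intro mult_mono one_le_power) auto
  then have "1 * x ^ card E \<le> real k * branching_factor k (card V) l x ^ t * x ^ card E"
    using x_nonneg by (intro mult_right_mono) auto
  then show ?thesis using True by simp
next
  case False
  let ?b = "branching_factor k (card V) l x"
  have "D \<subset> E" using False state(1) by blast
  then obtain e where e: "e \<in> E - D"
    "process_edge k V t (D, E) = (\<Union>S\<in>nsets e (k - 1). Pair (insert e D) ` substeps k V S t E)"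
    by (rule process_edge_unprocessed)
  then have edge: "finite e" "card e = k" using state(2) by (auto simp: nsets_def)
  have "(\<Sum>(D', E')\<in>process_edge k V t (D, E). x ^ card E') \<le>
      ?b ^ t * x ^ card E * (\<Sum>S\<in>nsets e (k - 1). 1)"
    unfolding e(2)
  proof (rule sum_UN_le_mult)
    fix S assume "S \<in> nsets e (k - 1)"
    then have "(\<Sum>E'\<in>substeps k V S t E. x ^ card E') \<le> ?b ^ t * x ^ card E"
      using fin_V state k_pos x_nonneg by (intro sum_substeps_le) (auto simp: nsets_def)
    then show "(\<Sum>(D', E')\<in>Pair (insert e D) ` substeps k V S t E. x ^ card E') \<le> ?b ^ t * x ^ card E * 1"
      by (subst sum.reindex) (auto simp: inj_on_def)
  qed (use edge fin_V x_nonneg in \<open>auto simp: finite_imp_finite_nsets finite_substeps\<close>)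
  also have "(\<Sum>S\<in>nsets e (k - 1). 1) = real k"
    using edge k_pos binomial_symmetric[of "k - 1" k] by simp
  finally show ?thesis by (simp add: mult_ac)
qed

lemma sum_explore_le:
  fixes x :: real and l :: nat
  assumes fin_V: "finite V" and "3 + 3 * t * j \<le> l" and k_pos: "1 \<le> k" and x_nonneg: "0 \<le> x"
  shows "(\<Sum>(D, E)\<in>explore k V t j. x ^ card E) \<le>
    (k * branching_factor k (card V) l x ^ t) ^ j * (card V ^ Suc k * (Suc k choose 3) * x ^ 3)"
  using assms(2)
proof (induction j)
  case 0
  have "(\<Sum>(D, E)\<in>explore k V t 0. x ^ card E) = (\<Sum>T\<in>triangles k V. x ^ card T)"
    by (simp add: sum.reindex inj_on_def)
  also have "\<dots> = (\<Sum>T\<in>triangles k V. x ^ 3)"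
    by (intro sum.cong refl) (simp add: triangles_def triangleD(2)[of k])
  also have "\<dots> = card (triangles k V) * x ^ 3" by simp
  also have "\<dots> \<le> real (card V ^ Suc k * (Suc k choose 3)) * x ^ 3"
    using card_triangles_le[OF fin_V, of k] x_nonneg
    by (intro mult_right_mono) (simp_all only: of_nat_le_iff zero_le_power)
  finally show ?case by simp
next
  case (Suc j)
  let ?c = "k * branching_factor k (card V) l x ^ t"
  have factor_nonneg: "0 \<le> ?c" using branching_factor_ge_1[of "card V" l x k] x_nonneg by simp
  have "(\<Sum>(D, E)\<in>explore k V t (Suc j). x ^ card E) \<le> ?c * (\<Sum>(D, E)\<in>explore k V t j. x ^ card E)"
    unfolding explore.simps
  proof (rule sum_UN_le_mult)
    fix s assume s_in: "s \<in> explore k V t j"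
    obtain D E where s_eq: "s = (D, E)" by force
    have bounds: "D \<subseteq> E" "E \<subseteq> nsets V k" "card E + 3 * t \<le> l"
      using explore_bounds[OF fin_V s_in[unfolded s_eq]] Suc.prems by auto
    show "finite (process_edge k V t s)"
      unfolding s_eq by (rule finite_process_edge[OF fin_V bounds(1,2)])
    show "(\<Sum>(D, E)\<in>process_edge k V t s. x ^ card E) \<le> ?c * (case s of (D, E) \<Rightarrow> x ^ card E)"
      unfolding s_eq using sum_process_edge_le[OF fin_V bounds k_pos x_nonneg] by simp
  qed (use fin_V x_nonneg in \<open>auto simp: finite_explore\<close>)
  also have "\<dots> \<le> ?c * (?c ^ j * (card V ^ Suc k * (Suc k choose 3) * x ^ 3))"
    using Suc factor_nonneg by (intro mult_left_mono) auto
  finally show ?case by (simp only: power_Suc mult.assoc)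
qed

lemma power_le_3:
  fixes b :: real
  assumes "0 \<le> b" "b \<le> 1 + 1 / t"
  shows "b ^ t \<le> 3"
proof -
  have "b \<le> exp (1 / t)" using assms(2) exp_ge_add_one_self[of "1 / real t"] by linarith
  then have "b ^ t \<le> exp (1 / t) ^ t" using assms(1) by (rule power_mono)
  also have "\<dots> = exp (t * (1 / t))" by (simp only: exp_of_nat_mult)
  also have "\<dots> \<le> exp 1" by simp
  also have "\<dots> \<le> 3" by (rule exp_le)
  finally show ?thesis .
qed

lemma sum_large_explore_le:
  fixes p :: real and l :: nat
  assumes fin_V: "finite V" and k_pos: "1 \<le> k" and p_bounds: "0 \<le> p" "6 * real k * p \<le> 1"
    and l_ge: "3 + 3 * t * M \<le> l"
    and subcritical: "branching_factor k (card V) l (6 * real k * p) \<le> 1 + 1 / t"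
  shows "(\<Sum>(D, E) | (D, E) \<in> explore k V t M \<and> M < card E. p ^ card E) \<le>
    card V ^ Suc k * (Suc k choose 3) * (1 / 2) ^ M"
proof -
  let ?x = "6 * real k * p" and ?N = "real (card V ^ Suc k * (Suc k choose 3))"
  let ?b = "branching_factor k (card V) l ?x"
  let ?X = "explore k V t M"
  have fin: "finite ?X" by (rule finite_explore[OF fin_V])
  have b_ge_1: "1 \<le> ?b" using p_bounds by (intro branching_factor_ge_1) auto
  have b_power: "?b ^ t \<le> 3" using b_ge_1 subcritical by (intro power_le_3) auto
  have "(\<Sum>(D, E) | (D, E) \<in> ?X \<and> M < card E. p ^ card E) \<le>
      (\<Sum>(D, E) | (D, E) \<in> ?X \<and> M < card E. ?x ^ card E / (6 * real k) ^ M)"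
  proof (intro sum_mono, clarify)
    fix D E :: "'a set set" assume "M < card E"
    then have "(6 * real k) ^ M * p ^ card E \<le> (6 * real k) ^ card E * p ^ card E"
      using k_pos p_bounds by (intro mult_right_mono power_increasing) auto
    then show "p ^ card E \<le> ?x ^ card E / (6 * real k) ^ M"
      using k_pos by (simp add: field_simps)
  qed
  also have "\<dots> \<le> (\<Sum>(D, E)\<in>?X. ?x ^ card E / (6 * real k) ^ M)"
    using fin p_bounds by (intro sum_mono2) auto
  also have "\<dots> = (\<Sum>(D, E)\<in>?X. ?x ^ card E) / (6 * real k) ^ M"
    by (simp add: sum_divide_distrib case_prod_unfold)
  also have "\<dots> \<le> (k * ?b ^ t) ^ M * (?N * ?x ^ 3) / (6 * real k) ^ M"
    using sum_explore_le[OF fin_V l_ge k_pos, of ?x] p_bounds by (intro divide_right_mono) auto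
  also have "\<dots> \<le> (real k * 3) ^ M * (?N * 1) / (6 * real k) ^ M"
  proof (intro divide_right_mono mult_mono)
    show "(real k * ?b ^ t) ^ M \<le> (real k * 3) ^ M"
      using b_ge_1 b_power by (intro power_mono mult_left_mono) auto
    show "?x ^ 3 \<le> 1" using p_bounds by (intro power_le_one) auto
  qed (use b_ge_1 p_bounds in auto)
  also have "\<dots> = ?N * ((real k * 3) / (6 * real k)) ^ M"
    by (simp only: power_divide times_divide_eq_right mult_1_left mult_1_right mult.commute)
  also have "(real k * 3) / (6 * real k) = 1 / 2" using k_pos by simp
  finally show ?thesis by simp
qed

section \<open>Absence of stuck sets\<close>

definition dense_sets :: "nat \<Rightarrow> 'a set \<Rightarrow> nat \<Rightarrow> 'a set set set" where
  "dense_sets k V s = {E. E \<subseteq> nsets V k \<and> card E = s \<and> 12 * card (\<Union>E) \<le> 7 * s}"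

lemma finite_dense_sets: "finite V \<Longrightarrow> finite (dense_sets k V s)"
  by (rule finite_subset[of _ "Pow (nsets V k)"]) (auto simp: dense_sets_def finite_imp_finite_nsets)

lemma card_nsets_nsets_le:
  assumes "card W \<le> v"
  shows "card (nsets (nsets W k) s) \<le> (v ^ k) ^ s"
proof -
  have "card W choose k \<le> v ^ k"
    using binomial_le_power[of "card W" k] power_mono[OF assms, of k] by simp
  then show ?thesis
    using binomial_le_power[of "card W choose k" s] power_mono[of "card W choose k" "v ^ k" s]
    by simp
qed

lemma card_sets_spanning_at_most_le:
  assumes "finite V" "V \<noteq> {}"
  shows "card {E. E \<subseteq> nsets V k \<and> card E = s \<and> card (\<Union>E) \<le> v} \<le> card V ^ v * (v ^ k) ^ s"
proof -
  let ?u = "min v (card V)"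
  let ?D = "{E. E \<subseteq> nsets V k \<and> card E = s \<and> card (\<Union>E) \<le> v}"
  have fin: "finite W" if "W \<in> nsets V ?u" for W using that by (simp add: nsets_def)
  have "?D \<subseteq> (\<Union>W\<in>nsets V ?u. nsets (nsets W k) s)"
  proof
    fix E assume E: "E \<in> ?D"
    then have sub: "\<Union>E \<subseteq> V" by (auto simp: nsets_def)
    then have "card (\<Union>E) \<le> ?u" using E card_mono[OF assms(1) sub] by simp
    then obtain W where W: "\<Union>E \<subseteq> W" "W \<subseteq> V" "card W = ?u"
      using exists_subset_between[OF _ min.cobounded2 sub assms(1)] by metis
    then have W_nsets: "W \<in> nsets V ?u"
      using finite_subset[OF W(2) assms(1)] by (simp add: nsets_def)
    have "E \<subseteq> nsets W k" using E W(1) by (auto simp: nsets_def)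
    moreover from this have "finite E"
      using finite_imp_finite_nsets[OF fin[OF W_nsets]] by (rule finite_subset)
    ultimately have "E \<in> nsets (nsets W k) s" using E by (simp add: nsets_def)
    then show "E \<in> (\<Union>W\<in>nsets V ?u. nsets (nsets W k) s)" using W_nsets by blast
  qed
  then have "card ?D \<le> card (\<Union>W\<in>nsets V ?u. nsets (nsets W k) s)"
    using assms(1) fin by (intro card_mono finite_UN_I finite_imp_finite_nsets)
  also have "\<dots> \<le> (\<Sum>W\<in>nsets V ?u. card (nsets (nsets W k) s))"
    using assms(1) by (intro card_UN_le) (simp add: finite_imp_finite_nsets)
  also have "\<dots> \<le> (\<Sum>W\<in>nsets V ?u. (v ^ k) ^ s)"
    by (intro sum_mono card_nsets_nsets_le) (simp add: nsets_def)
  also have "\<dots> = (card V choose ?u) * (v ^ k) ^ s" by simp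
  also have "\<dots> \<le> card V ^ v * (v ^ k) ^ s"
  proof (rule mult_le_mono1)
    have "card V choose ?u \<le> card V ^ ?u" by (rule binomial_le_power)
    also have "\<dots> \<le> card V ^ v"
      using assms by (intro power_increasing) (auto simp: Suc_le_eq card_gt_0_iff)
    finally show "card V choose ?u \<le> card V ^ v" .
  qed
  finally show ?thesis .
qed

lemma card_dense_sets_le:
  assumes "finite V" "V \<noteq> {}"
  shows "card (dense_sets k V s) \<le> card V ^ (7 * s div 12) * (s ^ k) ^ s"
proof -
  have "dense_sets k V s = {E. E \<subseteq> nsets V k \<and> card E = s \<and> card (\<Union>E) \<le> 7 * s div 12}"
    by (auto simp: dense_sets_def)
  also have "card \<dots> \<le> card V ^ (7 * s div 12) * ((7 * s div 12) ^ k) ^ s"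
    by (rule card_sets_spanning_at_most_le[OF assms])
  also have "\<dots> \<le> card V ^ (7 * s div 12) * (s ^ k) ^ s"
    by (intro mult_le_mono2 power_mono) auto
  finally show ?thesis .
qed

lemma sum_dense_sets_le:
  fixes n p :: real
  assumes V_nonempty: "finite V" "V \<noteq> {}" and n_eq: "n = card V"
    and p_bounds: "0 \<le> p" "p \<le> n powr (- 2 / 3)"
    and s_bounds: "1 \<le> s" "s \<le> M" and small: "real M ^ k * n powr (- 1 / 12) \<le> 1"
  shows "(\<Sum>E\<in>dense_sets k V s. p ^ card E) \<le> real M ^ k * n powr (- 1 / 12)"
proof -
  let ?q = "real M ^ k * n powr (- 1 / 12)"
  have n_ge_1: "1 \<le> n" using V_nonempty by (simp add: n_eq Suc_le_eq card_gt_0_iff)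
  have "(\<Sum>E\<in>dense_sets k V s. p ^ card E) = card (dense_sets k V s) * p ^ s"
    by (simp add: dense_sets_def)
  also have "\<dots> \<le> (n ^ (7 * s div 12) * (real s ^ k) ^ s) * p ^ s"
    using of_nat_mono[OF card_dense_sets_le[OF V_nonempty, of k s], where 'a = real] p_bounds(1)
    by (intro mult_right_mono) (simp_all add: n_eq)
  also have "\<dots> \<le> (n powr (7 * s / 12) * (real M ^ k) ^ s) * (n powr (- 2 / 3)) ^ s"
  proof (intro mult_mono power_mono)
    have "n ^ (7 * s div 12) = n powr real (7 * s div 12)" using n_ge_1 by (simp add: powr_realpow)
    also have "\<dots> \<le> n powr (7 * s / 12)"
      using n_ge_1 of_nat_div_le_of_nat[of "7 * s" 12] by (intro powr_mono) auto
    finally show "n ^ (7 * s div 12) \<le> n powr (7 * s / 12)" .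
  qed (use s_bounds p_bounds n_ge_1 in auto)
  also have "\<dots> = (n powr (7 / 12) * real M ^ k * n powr (- 2 / 3)) ^ s"
    using n_ge_1 by (simp add: power_mult_distrib powr_power mult.commute)
  also have "n powr (7 / 12) * real M ^ k * n powr (- 2 / 3) = ?q"
    by (simp add: mult_ac flip: powr_add)
  also have "?q ^ s \<le> ?q ^ 1" using s_bounds small n_ge_1 by (intro power_decreasing) auto
  finally show ?thesis by simp
qed

lemma stuck_in_dense_sets:
  assumes "stuck k (12 * k\<^sup>2) E" "E \<subseteq> nsets V k" "finite V" "1 \<le> k"
  shows "E \<in> dense_sets k V (card E)"
proof -
  have "finite E" using assms(2,3) finite_imp_finite_nsets finite_subset by blast
  then have "k\<^sup>2 * (24 * card (\<Union>E)) \<le> (12 * k\<^sup>2 + 2 * k * (k - 1)) * card E"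
    using stuck_imp_few_vertices[OF assms(1)] assms(4) by (simp add: mult_ac)
  also have "\<dots> \<le> (12 * k\<^sup>2 + 2 * k * k) * card E"
    by (intro mult_le_mono1 add_left_mono mult_le_mono2) simp
  also have "\<dots> = k\<^sup>2 * (14 * card E)" by (simp add: power2_eq_square algebra_simps)
  finally show ?thesis using assms(2,4) by (simp add: dense_sets_def)
qed

lemma stuck_imp_dense_or_large:
  assumes stuck: "stuck k (12 * k\<^sup>2) E" and E_sub: "E \<subseteq> nsets V k" and fin_V: "finite V"
    and k_pos: "1 \<le> k"
  shows "(\<exists>s\<in>{1..M}. \<exists>E'\<in>dense_sets k V s. E' \<subseteq> E) \<or>
    (\<exists>(D, E')\<in>explore k V (12 * k\<^sup>2) M. M < card E' \<and> E' \<subseteq> E)"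
  using stuck_imp_small_or_large[OF stuck E_sub fin_V, of M]
proof
  assume "\<exists>E'\<subseteq>E. stuck k (12 * k\<^sup>2) E' \<and> card E' \<le> M"
  then obtain E' where E': "E' \<subseteq> E" "stuck k (12 * k\<^sup>2) E'" "card E' \<le> M" by blast
  have E'_sub: "E' \<subseteq> nsets V k" using E'(1) E_sub by blast
  then have "finite E'" using finite_imp_finite_nsets[OF fin_V] by (rule finite_subset)
  then have "card E' \<in> {1..M}" using E'(2,3) by (auto simp: stuck_def Suc_le_eq card_gt_0_iff)
  moreover have "E' \<in> dense_sets k V (card E')"
    by (rule stuck_in_dense_sets[OF E'(2) E'_sub fin_V k_pos])
  ultimately show ?thesis using E'(1) by blast
qed blast

lemma prob_stuck_le:
  assumes fin_V: "finite V" and k_pos: "1 \<le> k" and p_bounds: "0 \<le> p" "p \<le> 1"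
  shows "measure_pmf.prob (random_subset (nsets V k) p) {E. \<exists>E'\<subseteq>E. stuck k (12 * k\<^sup>2) E'} \<le>
    (\<Sum>s=1..M. \<Sum>E\<in>dense_sets k V s. p ^ card E) +
    (\<Sum>(D, E) | (D, E) \<in> explore k V (12 * k\<^sup>2) M \<and> M < card E. p ^ card E)"
proof -
  let ?I = "nsets V k" and ?t = "12 * k\<^sup>2"
  let ?D = "\<Union>s\<in>{1..M}. dense_sets k V s"
  let ?X = "{(D, E). (D, E) \<in> explore k V ?t M \<and> M < card E}"
  let ?prob = "\<lambda>P. measure_pmf.prob (random_subset ?I p) {E. P E}"
  have fin_I: "finite ?I" by (rule finite_imp_finite_nsets[OF fin_V])
  have "?prob (\<lambda>E. \<exists>E'\<subseteq>E. stuck k ?t E') \<le> ?prob (\<lambda>E. (\<exists>E'\<in>?D. E' \<subseteq> E) \<or> (\<exists>s\<in>?X. snd s \<subseteq> E))"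
  proof (rule prob_random_subset_le_if_imp)
    fix E assume "E \<subseteq> ?I" "\<exists>E'\<subseteq>E. stuck k ?t E'"
    then obtain E1 where E1: "E1 \<subseteq> E" "stuck k ?t E1" "E1 \<subseteq> ?I" by blast
    from stuck_imp_dense_or_large[OF E1(2,3) fin_V k_pos, of M]
    show "(\<exists>E'\<in>?D. E' \<subseteq> E) \<or> (\<exists>s\<in>?X. snd s \<subseteq> E)"
    proof
      assume "\<exists>(D, E')\<in>explore k V ?t M. M < card E' \<and> E' \<subseteq> E1"
      then obtain D E' where "(D, E') \<in> ?X" "E' \<subseteq> E" using E1(1) by blast
      then show ?thesis by (intro disjI2 bexI[of _ "(D, E')"]) simp_all
    qed (use E1(1) in blast)
  qed
  also have "\<dots> \<le> ?prob (\<lambda>E. \<exists>E'\<in>?D. E' \<subseteq> E) + ?prob (\<lambda>E. \<exists>s\<in>?X. snd s \<subseteq> E)"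
    by (rule prob_disj_le)
  also have "\<dots> \<le> (\<Sum>E\<in>?D. p ^ card E) + (\<Sum>s\<in>?X. p ^ card (snd s))"
  proof (intro add_mono prob_random_subset_union_bound fin_I p_bounds)
    show "finite ?X"
      by (rule finite_subset[OF _ finite_explore[OF fin_V, of k ?t M]]) auto
    show "finite ?D" using fin_V by (simp add: finite_dense_sets)
    show "E \<subseteq> ?I" if "E \<in> ?D" for E using that by (auto simp: dense_sets_def)
    show "snd s \<subseteq> ?I" if "s \<in> ?X" for s
      using that explore_bounds[OF fin_V, of "fst s" "snd s" k ?t M] by auto
  qed
  also have "(\<Sum>E\<in>?D. p ^ card E) = (\<Sum>s=1..M. \<Sum>E\<in>dense_sets k V s. p ^ card E)"
    using fin_V
    by (intro sum.UNION_disjoint) (auto simp: finite_dense_sets, auto simp: dense_sets_def)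
  finally show ?thesis by (simp add: case_prod_unfold)
qed

lemma sum_dense_sets_logarithmic_le:
  fixes p :: real
  assumes card_V: "finite V" "card V = n" "0 < n" and p_bounds: "0 \<le> p" "p \<le> real n powr (- 2 / 3)"
    and M_bounds: "1 \<le> M" "real M \<le> L" and small: "L ^ Suc k * real n powr (- 1 / 12) \<le> 1"
  shows "(\<Sum>s=1..M. \<Sum>E\<in>dense_sets k V s. p ^ card E) \<le> L ^ Suc k * real n powr (- 1 / 12)"
proof -
  let ?q = "real M ^ k * real n powr (- 1 / 12)"
  have "real M ^ Suc k \<le> L ^ Suc k" using M_bounds by (intro power_mono) auto
  then have total_le: "real M * ?q \<le> L ^ Suc k * real n powr (- 1 / 12)"
    by (simp add: mult_right_mono flip: mult.assoc)
  moreover have "1 * ?q \<le> real M * ?q" using M_bounds(1) by (intro mult_right_mono) auto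
  ultimately have q_le_1: "?q \<le> 1" using small by linarith
  have "(\<Sum>s=1..M. \<Sum>E\<in>dense_sets k V s. p ^ card E) \<le> (\<Sum>s=1..M. ?q)"
    using card_V p_bounds q_le_1 by (intro sum_mono sum_dense_sets_le) auto
  also have "\<dots> = real M * ?q" by simp
  finally show ?thesis using total_le by linarith
qed

lemma half_power_le_inverse_power:
  assumes "0 < n" "real m * log 2 (real n) \<le> real M"
  shows "(1 / 2 :: real) ^ M \<le> 1 / real n ^ m"
proof -
  have "real n ^ m = (2 powr log 2 (real n)) powr real m" using assms(1) by (simp add: powr_realpow)
  also have "\<dots> = 2 powr (real m * log 2 (real n))" by (simp only: powr_powr mult.commute)
  also have "\<dots> \<le> 2 powr real M" using assms(2) by (intro powr_mono) auto
  finally have "real n ^ m \<le> 2 ^ M" by (simp add: powr_realpow)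
  then show ?thesis using assms(1) by (simp add: power_one_over frac_le)
qed

lemma sum_large_explore_logarithmic_le:
  fixes p :: real
  assumes card_V: "finite V" "card V = n" "0 < n" and k_pos: "1 \<le> k"
    and p_bounds: "0 \<le> p" "p \<le> x" "6 * real k * x \<le> 1"
    and M_bounds: "real (k + 2) * log 2 n \<le> M" "M \<le> L"
    and subcritical: "branching_factor k n (3 + 3 * real t * L) (6 * real k * x) \<le> 1 + 1 / t"
  shows "(\<Sum>(D, E) | (D, E) \<in> explore k V t M \<and> M < card E. p ^ card E) \<le> (Suc k choose 3) / n"
proof -
  have p_le_x: "6 * real k * p \<le> 6 * real k * x" using p_bounds by (intro mult_left_mono) auto
  then have p_le_1: "6 * real k * p \<le> 1" using p_bounds(3) by linarith
  have "branching_factor k n (3 + 3 * t * M) (6 * real k * p) \<le>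
      branching_factor k n (3 + 3 * real t * L) (6 * real k * x)"
    using p_le_x p_bounds M_bounds(2) by (intro branching_factor_mono) (auto intro: mult_left_mono)
  then have "branching_factor k (card V) (3 + 3 * t * M) (6 * real k * p) \<le> 1 + 1 / t"
    using subcritical card_V(2) by simp
  from sum_large_explore_le[OF card_V(1) k_pos p_bounds(1) p_le_1 order_refl this]
  have "(\<Sum>(D, E) | (D, E) \<in> explore k V t M \<and> M < card E. p ^ card E) \<le>
      n ^ Suc k * (Suc k choose 3) * (1 / 2) ^ M"
    using card_V(2) by simp
  also have "\<dots> \<le> n ^ Suc k * (Suc k choose 3) * (1 / real n ^ (k + 2))"
    using half_power_le_inverse_power[OF card_V(3), of "k + 2" M] M_bounds(1)
    by (intro mult_left_mono) auto
  also have "\<dots> = (Suc k choose 3) / n" using card_V(3) by simp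
  finally show ?thesis .
qed

lemma branching_factor_tendsto:
  fixes a b r :: real
  assumes "0 < a" "0 < b" "0 < r"
  shows "(\<lambda>n. branching_factor k (real n) (3 + r * (a * log 2 n + 1)) (b * real n powr (- 2 / 3)))
    \<longlonglongrightarrow> 1 + real (Suc k choose 3) * b ^ 3"
proof -
  have "(\<lambda>n. (real n)\<^sup>2 * (b * real n powr (- 2 / 3)) ^ 3) \<longlonglongrightarrow> b ^ 3"
    using assms by real_asymp
  moreover have "(\<lambda>n. (3 + r * (a * log 2 n + 1)) * real n * (b * real n powr (- 2 / 3))\<^sup>2) \<longlonglongrightarrow> 0"
    using assms by real_asymp
  moreover have "(\<lambda>n. (3 + r * (a * log 2 n + 1))\<^sup>2 * (b * real n powr (- 2 / 3))) \<longlonglongrightarrow> 0"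
    using assms by real_asymp
  ultimately have "(\<lambda>n. branching_factor k (real n) (3 + r * (a * log 2 n + 1)) (b * real n powr (- 2 / 3)))
    \<longlonglongrightarrow> 1 + real (Suc k choose 3) * (b ^ 3 + 0 + 0)"
    unfolding branching_factor_def by (intro tendsto_add tendsto_mult_left tendsto_const)
  then show ?thesis by simp
qed

lemma prob_stuck_logarithmic_le:
  fixes p c :: real and n k :: nat
  defines "t \<equiv> 12 * k\<^sup>2" and "L \<equiv> real (k + 2) * log 2 n + 1"
  assumes k_pos: "1 \<le> k" and n_ge: "2 \<le> n" and c_bounds: "0 < c" "6 * real k * c \<le> 1"
    and p_bounds: "0 \<le> p" "p \<le> 1" "p \<le> c * real n powr (- 2 / 3)"
    and small: "L ^ Suc k * real n powr (- 1 / 12) \<le> 1"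
    and subcritical: "branching_factor k n (3 + 3 * real t * L)
      (6 * real k * c * real n powr (- 2 / 3)) \<le> 1 + 1 / t"
  shows "measure_pmf.prob (random_subset (nsets {..<n} k) p) {E. \<exists>E'\<subseteq>E. stuck k t E'} \<le>
    L ^ Suc k * real n powr (- 1 / 12) + (Suc k choose 3) / real n"
proof -
  define M where "M = nat \<lceil>real (k + 2) * log 2 (real n)\<rceil>"
  let ?x = "c * real n powr (- 2 / 3)"
  have card_V: "finite {..<n}" "card {..<n} = n" "0 < n" using n_ge by auto
  have "1 \<le> log 2 (real n)" using n_ge by simp
  then have "1 * 1 \<le> real (k + 2) * log 2 (real n)" by (intro mult_mono) auto
  then have M_bounds: "real (k + 2) * log 2 n \<le> M" "M \<le> L" "1 \<le> M"
    unfolding M_def L_def by linarith+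
  have "real n powr (- 2 / 3) \<le> real n powr 0" using n_ge by (intro powr_mono) auto
  then have "6 * real k * c * real n powr (- 2 / 3) \<le> 1 * 1"
    using c_bounds n_ge by (intro mult_mono) auto
  then have x_le: "6 * real k * ?x \<le> 1" by (simp add: mult.assoc)
  have "1 * c \<le> 6 * real k * c" using k_pos c_bounds(1) by (intro mult_right_mono) auto
  then have "c \<le> 1" using c_bounds(2) by linarith
  then have "?x \<le> 1 * real n powr (- 2 / 3)" by (intro mult_right_mono) auto
  then have "p \<le> real n powr (- 2 / 3)" using p_bounds(3) by linarith
  then have "(\<Sum>s=1..M. \<Sum>E\<in>dense_sets k {..<n} s. p ^ card E) \<le> L ^ Suc k * real n powr (- 1 / 12)"
    using card_V p_bounds(1) M_bounds small by (intro sum_dense_sets_logarithmic_le) auto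
  moreover have "(\<Sum>(D, E) | (D, E) \<in> explore k {..<n} t M \<and> M < card E. p ^ card E) \<le>
      (Suc k choose 3) / n"
    using subcritical
    by (intro sum_large_explore_logarithmic_le[OF card_V k_pos p_bounds(1,3) x_le M_bounds(1,2)])
      (simp add: mult.assoc)
  ultimately show ?thesis
    using prob_stuck_le[OF card_V(1) k_pos p_bounds(1,2), of M] by (simp add: t_def)
qed

lemma prob_stuck_tendsto_0:
  fixes p :: "nat \<Rightarrow> real" and c :: real
  assumes k_pos: "1 \<le> k" and c_bounds: "0 < c" "6 * real k * c \<le> 1"
    "real (12 * k\<^sup>2 * (Suc k choose 3)) * (6 * real k * c) ^ 3 < 1"
    and p_bounds: "\<And>n. 0 \<le> p n \<and> p n \<le> 1" "\<forall>\<^sub>F n in sequentially. p n \<le> c * real n powr (- 2 / 3)"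
  shows "(\<lambda>n. measure_pmf.prob (random_subset (nsets {..<n} k) (p n)) {E. \<exists>E'\<subseteq>E. stuck k (12 * k\<^sup>2) E'})
    \<longlonglongrightarrow> 0"
proof -
  let ?t = "12 * k\<^sup>2" and ?L = "\<lambda>n. real (k + 2) * log 2 (real n) + 1"
  have dense: "(\<lambda>n. ?L n ^ Suc k * real n powr (- 1 / 12)) \<longlonglongrightarrow> 0" by real_asymp
  have large: "(\<lambda>n. (Suc k choose 3) / real n) \<longlonglongrightarrow> 0" by real_asymp
  have small: "\<forall>\<^sub>F n in sequentially. ?L n ^ Suc k * real n powr (- 1 / 12) < 1"
    using dense by (rule order_tendstoD) simp
  have subcritical: "\<forall>\<^sub>F n in sequentially. branching_factor k (real n) (3 + 3 * real ?t * ?L n)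
      (6 * real k * c * real n powr (- 2 / 3)) < 1 + 1 / ?t"
  proof (rule order_tendstoD(2)[OF branching_factor_tendsto])
    show "1 + real (Suc k choose 3) * (6 * real k * c) ^ 3 < 1 + 1 / ?t"
      using c_bounds(3) k_pos by (simp add: pos_less_divide_eq mult_ac)
  qed (use k_pos c_bounds in auto)
  have "\<forall>\<^sub>F n in sequentially. measure_pmf.prob (random_subset (nsets {..<n} k) (p n))
      {E. \<exists>E'\<subseteq>E. stuck k ?t E'} \<le> ?L n ^ Suc k * real n powr (- 1 / 12) + (Suc k choose 3) / real n"
    using small subcritical p_bounds(2) eventually_ge_at_top[of 2]
  proof eventually_elim
    case (elim n)
    show ?case
      using p_bounds(1)[of n]
      by (intro prob_stuck_logarithmic_le[OF k_pos elim(4) c_bounds(1,2) _ _ elim(3)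
          less_imp_le[OF elim(1)] less_imp_le[OF elim(2)]]) simp_all
  qed
  moreover have "(\<lambda>n. ?L n ^ Suc k * real n powr (- 1 / 12) + (Suc k choose 3) / real n) \<longlonglongrightarrow> 0"
    using tendsto_add[OF dense large] unfolding add_0_right .
  ultimately show ?thesis
    by (rule tendsto_sandwich[OF always_eventually _ tendsto_const, rotated]) simp
qed

section \<open>The target hypergraph\<close>

definition hypergraph_union :: "'a hypergraph \<Rightarrow> 'a hypergraph \<Rightarrow> 'a hypergraph" where
  "hypergraph_union G H = (hverts G \<union> hverts H, hedges G \<union> hedges H)"

definition facet_hypergraph :: "'a set \<Rightarrow> 'a set \<Rightarrow> 'a hypergraph" where
  "facet_hypergraph W A = (W, facets W A)"

definition star_hypergraph :: "'a set \<Rightarrow> 'a set \<Rightarrow> 'a hypergraph" where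
  "star_hypergraph S Z = (S \<union> Z, (\<lambda>z. insert z S) ` Z)"

definition target :: "nat \<Rightarrow> nat \<Rightarrow> nat hypergraph" where
  "target k t = hypergraph_union (facet_hypergraph {..k} {..<3})
     (star_hypergraph {k<..<2 * k} {2 * k..<2 * k + t})"

lemma uniform_hypergraph_union:
  assumes "uniform_hypergraph k G" "uniform_hypergraph k H"
  shows "uniform_hypergraph k (hypergraph_union G H)"
  using assms nsets_mono[of "hverts G" "hverts G \<union> hverts H" k]
    nsets_mono[of "hverts H" "hverts G \<union> hverts H" k]
  by (auto simp: uniform_hypergraph_def hypergraph_union_def)

lemma uniform_facet_hypergraph:
  assumes "finite W" "card W = Suc k" "A \<subseteq> W"
  shows "uniform_hypergraph k (facet_hypergraph W A)"
  using assms(1) facets_subset_nsets[OF assms(3) order_refl assms(1,2)]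
  by (simp add: uniform_hypergraph_def facet_hypergraph_def)

lemma uniform_star_hypergraph:
  assumes "finite S" "finite Z" "Suc (card S) = k" "S \<inter> Z = {}"
  shows "uniform_hypergraph k (star_hypergraph S Z)"
  using assms by (auto simp: uniform_hypergraph_def star_hypergraph_def nsets_def card_insert_if)

lemma codegree_star_hypergraph:
  assumes "S \<inter> Z = {}"
  shows "codegree (hedges (star_hypergraph S Z)) S = card Z"
proof -
  have "{e \<in> hedges (star_hypergraph S Z). S \<subseteq> e} = (\<lambda>z. insert z S) ` Z"
    by (auto simp: star_hypergraph_def)
  moreover have "inj_on (\<lambda>z. insert z S) Z" using assms by (intro inj_onI) blast
  ultimately show ?thesis by (simp add: codegree_def card_image)
qed

lemma d_density_le_m_density:
  assumes "uniform_hypergraph k G" "subhypergraph H G"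
  shows "d_density k H \<le> m_density k G"
  unfolding m_density_def
proof (rule Max_ge)
  have "finite (hedges G)"
    using assms(1) finite_imp_finite_nsets finite_subset by (auto simp: uniform_hypergraph_def)
  then have "finite (Pow (hverts G) \<times> Pow (hedges G))"
    using assms(1) by (simp add: uniform_hypergraph_def)
  moreover have "{H. subhypergraph H G} \<subseteq> Pow (hverts G) \<times> Pow (hedges G)"
    by (auto simp: subhypergraph_def)
  ultimately have "finite {H. subhypergraph H G}" by (rule finite_subset[rotated])
  then show "finite {d_density k H |H. subhypergraph H G}"
    unfolding setcompr_eq_image by (rule finite_imageI)
qed (use assms(2) in blast)

lemma uniform_target:
  assumes "2 \<le> k"
  shows "uniform_hypergraph k (target k t)"
  unfolding target_def using assms
  by (intro uniform_hypergraph_union uniform_facet_hypergraph uniform_star_hypergraph) auto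

lemma m_density_target:
  assumes "2 \<le> k"
  shows "2 \<le> m_density k (target k t)"
proof -
  have "card (facets {..k} {..<3}) = 3" using assms by (subst card_facets) auto
  then have "d_density k (facet_hypergraph {..k} {..<3}) = 2"
    by (simp add: d_density_def facet_hypergraph_def)
  moreover have "subhypergraph (facet_hypergraph {..k} {..<3}) (target k t)"
    by (auto simp: subhypergraph_def target_def hypergraph_union_def facet_hypergraph_def facets_def)
  ultimately show ?thesis
    using d_density_le_m_density[OF uniform_target[OF assms]] by metis
qed

lemma has_triangle_target:
  assumes "2 \<le> k"
  shows "has_triangle k (hedges (target k t))"
  unfolding has_triangle_def
proof (intro exI conjI)
  show "triangle k (facets {..k} {..<3})" using assms by (intro triangle_facets) auto
qed (auto simp: target_def hypergraph_union_def facet_hypergraph_def)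

lemma has_star_target: "has_star k t (hedges (target k t))"
proof -
  let ?S = "{k<..<2 * k}" and ?Z = "{2 * k..<2 * k + t}"
  let ?E = "hedges (star_hypergraph ?S ?Z)"
  have "?S \<inter> ?Z = {}" by auto
  from codegree_star_hypergraph[OF this] have "t \<le> codegree ?E ?S" by simp
  moreover have "card ?S = k - 1" by simp
  ultimately have "?S \<in> heavy_sets k t ?E" unfolding heavy_sets_def by blast
  then have "has_star k t ?E" unfolding has_star_def by blast
  moreover have "?E \<subseteq> hedges (target k t)" by (simp add: target_def hypergraph_union_def)
  moreover have "finite (hedges (target k t))"
    by (simp add: target_def hypergraph_union_def facet_hypergraph_def finite_facets star_hypergraph_def)
  ultimately show ?thesis by (rule has_star_mono)
qed

section \<open>Isomorphisms\<close>

lemma hypergraph_iso_sym: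
  assumes "hypergraph_iso G H" "hedges G \<subseteq> Pow (hverts G)"
  shows "hypergraph_iso H G"
proof -
  obtain f where f: "bij_betw f (hverts G) (hverts H)" "(`) f ` hedges G = hedges H"
    using assms(1) by (auto simp: hypergraph_iso_def)
  let ?g = "inv_into (hverts G) f"
  have "?g ` f ` e = e" if "e \<in> hedges G" for e
    using that assms(2) f(1) by (intro inv_into_image_cancel) (auto simp: bij_betw_def)
  then have "(`) ?g ` hedges H = hedges G"
    unfolding f(2)[symmetric] image_image by simp
  then show ?thesis
    using bij_betw_inv_into[OF f(1)] by (auto simp: hypergraph_iso_def)
qed

lemma facets_image:
  assumes "inj_on f W" "A \<subseteq> W"
  shows "(`) f ` facets W A = facets (f ` W) (f ` A)"
proof -
  have "f ` (W - {v}) = f ` W - {f v}" if "v \<in> A" for v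
    using inj_on_image_set_diff[OF assms(1), of W "{v}"] assms(2) that by auto
  then show ?thesis unfolding facets_def image_image by (rule image_cong[OF refl])
qed

lemma has_triangle_iso:
  assumes "hypergraph_iso G H" "hedges G \<subseteq> Pow (hverts G)" "has_triangle k (hedges G)"
  shows "has_triangle k (hedges H)"
proof -
  obtain f where f: "inj_on f (hverts G)" "(`) f ` hedges G = hedges H"
    using assms(1) by (auto simp: hypergraph_iso_def bij_betw_def)
  obtain T where T: "T \<subseteq> hedges G" "triangle k T" using assms(3) by (auto simp: has_triangle_def)
  obtain A where A: "A \<subseteq> \<Union>T" "card A = 3" "T = facets (\<Union>T) A" using triangle_eq_facets[OF T(2)] .
  have inj: "inj_on f (\<Union>T)" using T(1) assms(2) by (intro inj_on_subset[OF f(1)]) blast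
  then have "card (f ` \<Union>T) = Suc k" "card (f ` A) = 3"
    using card_image[OF inj] card_image[OF inj_on_subset[OF inj A(1)]] triangleD(4)[OF T(2)] A(2)
    by simp_all
  then have "triangle k (facets (f ` \<Union>T) (f ` A))"
    using A(1) by (intro triangle_facets) auto
  also have "facets (f ` \<Union>T) (f ` A) = (`) f ` facets (\<Union>T) A"
    by (rule facets_image[OF inj A(1), symmetric])
  also have "\<dots> = (`) f ` T" by (rule arg_cong[OF A(3)[symmetric]])
  finally have "triangle k ((`) f ` T)" .
  moreover have "(`) f ` T \<subseteq> hedges H" using T(1) unfolding f(2)[symmetric] by (rule image_mono)
  ultimately show ?thesis unfolding has_triangle_def by blast
qed

lemma has_star_iso:
  assumes "hypergraph_iso G H" "hedges G \<subseteq> Pow (hverts G)" "has_star k t (hedges G)"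
    and "finite (hedges H)" "0 < t"
  shows "has_star k t (hedges H)"
proof -
  obtain f where f: "inj_on f (hverts G)" "(`) f ` hedges G = hedges H"
    using assms(1) by (auto simp: hypergraph_iso_def bij_betw_def)
  obtain S where S: "S \<in> heavy_sets k t (hedges G)" using assms(3) by (auto simp: has_star_def)
  let ?A = "{e \<in> hedges G. S \<subseteq> e}"
  obtain e where "e \<in> hedges G" "S \<subseteq> e" using heavy_sets_subset_edge[OF assms(5) S] by blast
  then have "inj_on f S" using assms(2) by (intro inj_on_subset[OF f(1)]) blast
  then have "card (f ` S) = k - 1" using S by (simp add: card_image heavy_sets_def)
  moreover have "t \<le> codegree (hedges H) (f ` S)"
  proof -
    have "inj_on ((`) f) ?A"
      using assms(2) by (intro inj_on_subset[OF inj_on_image_Pow[OF f(1)]]) blast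
    then have "codegree (hedges G) S = card ((`) f ` ?A)" by (simp add: codegree_def card_image)
    also have "\<dots> \<le> codegree (hedges H) (f ` S)"
      unfolding codegree_def using f(2) assms(4) by (intro card_mono) auto
    finally show ?thesis using S by (simp add: heavy_sets_def)
  qed
  ultimately have "f ` S \<in> heavy_sets k t (hedges H)" by (simp add: heavy_sets_def)
  then show ?thesis by (auto simp: has_star_def)
qed

lemma ex_bij_betw_image_eq:
  assumes "finite W" "finite W'" "card W = card W'" "A \<subseteq> W" "A' \<subseteq> W'" "card A = card A'"
  shows "\<exists>f. bij_betw f W W' \<and> f ` A = A'"
proof -
  have fin: "finite A" "finite A'" using assms finite_subset by auto
  obtain g where g: "bij_betw g A A'" using finite_same_card_bij[OF fin assms(6)] by blast
  have "card (W - A) = card (W' - A')" using assms fin by (simp add: card_Diff_subset)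
  then obtain h where h: "bij_betw h (W - A) (W' - A')"
    using finite_same_card_bij[of "W - A" "W' - A'"] assms(1,2) by blast
  let ?f = "\<lambda>x. if x \<in> A then g x else h x"
  have "bij_betw ?f (A \<union> (W - A)) (A' \<union> (W' - A'))"
    by (rule bij_betw_disjoint_Un[OF g h]) auto
  then have "bij_betw ?f W W'" using assms(4,5) by (simp add: Un_absorb1)
  moreover have "?f ` A = A'" using g by (auto simp: bij_betw_def)
  ultimately show ?thesis by blast
qed

lemma hypergraph_iso_facet_hypergraph:
  assumes "finite W" "finite W'" "card W = card W'" "A \<subseteq> W" "A' \<subseteq> W'" "card A = card A'"
  shows "hypergraph_iso (facet_hypergraph W A) (facet_hypergraph W' A')"
proof -
  obtain f where f: "bij_betw f W W'" "f ` A = A'" using ex_bij_betw_image_eq[OF assms] by blast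
  then have "(`) f ` facets W A = facets W' A'"
    using facets_image[of f W A] assms(4) by (simp add: bij_betw_def)
  then show ?thesis using f(1) by (auto simp: hypergraph_iso_def facet_hypergraph_def)
qed

lemma hypergraph_iso_star_hypergraph:
  assumes "finite S" "finite S'" "card S = card S'" "finite Z" "finite Z'" "card Z = card Z'"
    and "S \<inter> Z = {}" "S' \<inter> Z' = {}"
  shows "hypergraph_iso (star_hypergraph S Z) (star_hypergraph S' Z')"
proof -
  have "card (S \<union> Z) = card (S' \<union> Z')" using assms by (simp add: card_Un_disjoint)
  then obtain f where f: "bij_betw f (S \<union> Z) (S' \<union> Z')" "f ` S = S'"
    using ex_bij_betw_image_eq[of "S \<union> Z" "S' \<union> Z'" S S'] assms by auto
  have "f ` Z = f ` (S \<union> Z) - f ` S"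
    using inj_on_image_set_diff[of f "S \<union> Z" "S \<union> Z" S] f(1) assms(7)
    by (auto simp: bij_betw_def Un_Diff)
  also have "\<dots> = Z'" using f assms(8) by (auto simp: bij_betw_def)
  finally have "(`) f ` (\<lambda>z. insert z S) ` Z = (\<lambda>z. insert z S') ` Z'"
    using f(2) by (auto simp: image_image)
  then show ?thesis using f(1) by (auto simp: hypergraph_iso_def star_hypergraph_def)
qed

lemma hypergraph_iso_union:
  assumes "hypergraph_iso G G'" "hypergraph_iso H H'"
    and "hedges G \<subseteq> Pow (hverts G)" "hedges H \<subseteq> Pow (hverts H)"
    and disjoint: "hverts G \<inter> hverts H = {}" "hverts G' \<inter> hverts H' = {}"
  shows "hypergraph_iso (hypergraph_union G H) (hypergraph_union G' H')"
proof -
  obtain g where g: "bij_betw g (hverts G) (hverts G')" "(`) g ` hedges G = hedges G'"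
    using assms(1) by (auto simp: hypergraph_iso_def)
  obtain h where h: "bij_betw h (hverts H) (hverts H')" "(`) h ` hedges H = hedges H'"
    using assms(2) by (auto simp: hypergraph_iso_def)
  let ?f = "\<lambda>x. if x \<in> hverts G then g x else h x"
  have "bij_betw ?f (hverts G \<union> hverts H) (hverts G' \<union> hverts H')"
    by (rule bij_betw_disjoint_Un[OF g(1) h(1) disjoint])
  moreover have "?f ` e = g ` e" if "e \<in> hedges G" for e
    using that assms(3) by (intro image_cong) auto
  then have "(`) ?f ` hedges G = hedges G'" unfolding g(2)[symmetric] by (rule image_cong[OF refl])
  moreover have "?f ` e = h ` e" if "e \<in> hedges H" for e
    using that assms(4) disjoint(1) by (intro image_cong) auto
  then have "(`) ?f ` hedges H = hedges H'" unfolding h(2)[symmetric] by (rule image_cong[OF refl])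
  ultimately show ?thesis
    unfolding hypergraph_iso_def hypergraph_union_def by (intro exI[of _ ?f]) (simp add: image_Un)
qed

lemma heavy_set_imp_star:
  assumes "S \<in> heavy_sets k t E" "E \<subseteq> nsets V k" "2 \<le> k"
  obtains Z where "finite Z" "card Z = t" "S \<inter> Z = {}" "(\<lambda>z. insert z S) ` Z \<subseteq> E"
proof -
  have S_heavy: "card S = k - 1" "t \<le> codegree E S" using assms(1) by (simp_all add: heavy_sets_def)
  have "finite S" by (rule card_ge_0_finite) (use S_heavy(1) assms(3) in simp)
  let ?Z = "{z. z \<notin> S \<and> insert z S \<in> E}"
  have "{e \<in> E. S \<subseteq> e} = (\<lambda>z. insert z S) ` ?Z"
  proof
    show "{e \<in> E. S \<subseteq> e} \<subseteq> (\<lambda>z. insert z S) ` ?Z"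
    proof
      fix e assume e: "e \<in> {e \<in> E. S \<subseteq> e}"
      then have "card (e - S) = 1"
        using assms(2,3) S_heavy(1) \<open>finite S\<close> by (auto simp: card_Diff_subset nsets_def)
      then obtain z where "e - S = {z}" by (auto simp: card_1_singleton_iff)
      then have "z \<notin> S" "e = insert z S" using e by blast+
      then show "e \<in> (\<lambda>z. insert z S) ` ?Z" using e by blast
    qed
  qed auto
  moreover have "inj_on (\<lambda>z. insert z S) ?Z" by (intro inj_onI) blast
  ultimately have "t \<le> card ?Z" using S_heavy(2) by (simp add: codegree_def card_image)
  then obtain Z where "Z \<subseteq> ?Z" "card Z = t" "finite Z" by (rule obtain_subset_with_card_n)
  then show ?thesis by (intro that[of Z]) auto
qed

lemma target_copy:
  assumes E_sub: "E \<subseteq> nsets V k" and k_ge: "2 \<le> k" and t_pos: "0 < t"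
    and triangle: "has_triangle k (E \<inter> Pow U)" and star: "has_star k t (E \<inter> Pow U')"
    and disjoint: "U \<inter> U' = {}"
  shows "\<exists>H. subhypergraph H (V, E) \<and> hypergraph_iso H (target k t)"
proof -
  obtain T where T: "T \<subseteq> E \<inter> Pow U" "triangle k T" using triangle by (auto simp: has_triangle_def)
  obtain A where A: "A \<subseteq> \<Union>T" "card A = 3" "T = facets (\<Union>T) A" using triangle_eq_facets[OF T(2)] .
  obtain S where S: "S \<in> heavy_sets k t (E \<inter> Pow U')" using star by (auto simp: has_star_def)
  obtain Z where Z: "finite Z" "card Z = t" "S \<inter> Z = {}" "(\<lambda>z. insert z S) ` Z \<subseteq> E \<inter> Pow U'"
    by (rule heavy_set_imp_star[OF S _ k_ge]) (use E_sub in blast)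
  have card_S: "card S = k - 1" "finite S"
    using S k_ge by (auto simp: heavy_sets_def intro: card_ge_0_finite)
  have "Z \<noteq> {}" using Z(2) t_pos by force
  then have star_sub: "S \<union> Z \<subseteq> U'" using Z(4) by blast
  let ?G = "facet_hypergraph (\<Union>T) A" and ?H = "star_hypergraph S Z"
  have edges: "hedges (hypergraph_union ?G ?H) \<subseteq> E"
    using T(1) A(3) Z(4)
    by (auto simp: hypergraph_union_def facet_hypergraph_def star_hypergraph_def)
  have closed: "hedges ?G \<subseteq> Pow (hverts ?G)" "hedges ?H \<subseteq> Pow (hverts ?H)"
    by (auto simp: facet_hypergraph_def star_hypergraph_def facets_def)
  have "\<Union>T \<subseteq> U" "\<Union>T \<subseteq> V" using T(1) E_sub by (auto simp: nsets_def)
  moreover have "S \<union> Z \<subseteq> V" using \<open>Z \<noteq> {}\<close> Z(4) E_sub by (auto simp: nsets_def)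
  ultimately have "subhypergraph (hypergraph_union ?G ?H) (V, E)"
    using edges closed
    by (auto simp: subhypergraph_def hypergraph_union_def facet_hypergraph_def star_hypergraph_def)
  moreover have "hypergraph_iso (hypergraph_union ?G ?H) (target k t)"
    unfolding target_def
  proof (rule hypergraph_iso_union[OF _ _ closed])
    show "hypergraph_iso ?G (facet_hypergraph {..k} {..<3})"
      using triangleD(3,4)[OF T(2)] A(1,2) k_ge by (intro hypergraph_iso_facet_hypergraph) auto
    show "hypergraph_iso ?H (star_hypergraph {k<..<2 * k} {2 * k..<2 * k + t})"
      using card_S Z by (intro hypergraph_iso_star_hypergraph) auto
    show "hverts ?G \<inter> hverts ?H = {}"
      using \<open>\<Union>T \<subseteq> U\<close> star_sub disjoint by (auto simp: facet_hypergraph_def star_hypergraph_def)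
  qed (use k_ge in \<open>auto simp: facet_hypergraph_def star_hypergraph_def\<close>)
  ultimately show ?thesis by blast
qed

section \<open>The 0-statement\<close>

lemma arrows_imp_forces:
  assumes arrows: "arrows (V, E) F" and "finite E" "0 < t"
    and target: "uniform_hypergraph k F" "has_triangle k (hedges F)" "has_star k t (hedges F)"
  shows "forces (has_triangle k) (has_star k t) E"
  unfolding forces_def
proof (intro allI impI)
  fix R assume "R \<subseteq> E"
  obtain H b where H: "subhypergraph H (V, E)" "hypergraph_iso H F" "\<forall>e\<in>hedges H. (e \<in> R) = b"
    using arrows[unfolded arrows_def, rule_format, of "\<lambda>e. e \<in> R"] by blast
  have sub: "hedges H \<subseteq> E" "hedges H \<subseteq> Pow (hverts H)" using H(1) by (auto simp: subhypergraph_def)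
  have iso: "hypergraph_iso F H" by (rule hypergraph_iso_sym[OF H(2) sub(2)])
  have closed: "hedges F \<subseteq> Pow (hverts F)"
    using target(1) by (auto simp: uniform_hypergraph_def nsets_def)
  have triangle: "has_triangle k (hedges H)" by (rule has_triangle_iso[OF iso closed target(2)])
  have star: "has_star k t (hedges H)"
    by (rule has_star_iso[OF iso closed target(3) finite_subset[OF sub(1) assms(2)] assms(3)])
  show "has_triangle k R \<or> has_star k t (E - R)"
  proof (cases b)
    case True
    then have "hedges H \<subseteq> R" using H(3) by blast
    then show ?thesis using has_triangle_mono[OF triangle] by blast
  next
    case False
    then have "hedges H \<subseteq> E - R" using H(3) sub(1) by blast
    then show ?thesis using has_star_mono[OF star] assms(2) by blast
  qed
qed

lemma prob_arrows_random_hypergraph: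
  "measure_pmf.prob (random_hypergraph k n p) {G. arrows G F} =
   measure_pmf.prob (random_subset (nsets {..<n} k) p) {E. arrows ({..<n}, E) F}"
  by (simp add: random_hypergraph_conv_random_subset vimage_def)

lemma prob_arrows_target_le:
  assumes k_ge: "2 \<le> k" and t_pos: "0 < t"
  shows "measure_pmf.prob (random_hypergraph k n p) {G. arrows G (target k t)} \<le>
    measure_pmf.prob (random_subset (nsets {..<n} k) p) {E. \<exists>E'\<subseteq>E. stuck k t E'}"
  unfolding prob_arrows_random_hypergraph
proof (rule prob_random_subset_le_if_imp)
  fix E assume E_sub: "E \<subseteq> nsets {..<n} k" and arrows: "arrows ({..<n}, E) (target k t)"
  have fin: "finite E"
    using E_sub finite_imp_finite_nsets[OF finite_lessThan] by (rule finite_subset)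
  have "forces (has_triangle k) (has_star k t) E"
    by (rule arrows_imp_forces[OF arrows fin t_pos uniform_target has_triangle_target has_star_target])
      (rule k_ge)+
  then show "\<exists>E'\<subseteq>E. stuck k t E'" by (rule forces_imp_stuck_subset[OF fin t_pos])
qed

lemma zero_statement:
  assumes k_ge: "2 \<le> k"
  shows "\<exists>c>0. \<forall>p :: nat \<Rightarrow> real. (\<forall>n. 0 \<le> p n \<and> p n \<le> 1) \<longrightarrow>
    (\<forall>\<^sub>F n in sequentially. p n \<le> c * real n powr (- 2 / 3)) \<longrightarrow>
    (\<lambda>n. measure_pmf.prob (random_hypergraph k n (p n)) {G. arrows G (target k (12 * k\<^sup>2))}) \<longlonglongrightarrow> 0"
proof (intro exI conjI allI impI)
  let ?t = "12 * k\<^sup>2"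
  define a where "a = real (?t * (Suc k choose 3))"
  define c where "c = 1 / (6 * real k * (a + 1))"
  have a_nonneg: "0 \<le> a" by (simp add: a_def)
  then show c_pos: "0 < c" using k_ge by (simp add: c_def)
  have six_k_c: "6 * real k * c = 1 / (a + 1)" using k_ge by (simp add: c_def)
  then have six_k_c_le: "6 * real k * c \<le> 1" using a_nonneg by simp
  have "(1 / (a + 1)) ^ 3 \<le> (1 / (a + 1)) ^ 1" using a_nonneg by (intro power_decreasing) auto
  then have "a * (1 / (a + 1)) ^ 3 \<le> a * (1 / (a + 1))"
    using a_nonneg by (intro mult_left_mono) auto
  also have "\<dots> < 1" using a_nonneg by simp
  finally have small: "real (?t * (Suc k choose 3)) * (6 * real k * c) ^ 3 < 1"
    unfolding six_k_c a_def .
  fix p :: "nat \<Rightarrow> real"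
  assume p_bounds: "\<forall>n. 0 \<le> p n \<and> p n \<le> 1" "\<forall>\<^sub>F n in sequentially. p n \<le> c * real n powr (- 2 / 3)"
  have k_pos: "1 \<le> k" and t_pos: "0 < ?t" using k_ge by auto
  show "(\<lambda>n. measure_pmf.prob (random_hypergraph k n (p n)) {G. arrows G (target k ?t)}) \<longlonglongrightarrow> 0"
  proof (rule tendsto_sandwich[OF _ _ tendsto_const])
    show "(\<lambda>n. measure_pmf.prob (random_subset (nsets {..<n} k) (p n)) {E. \<exists>E'\<subseteq>E. stuck k ?t E'}) \<longlonglongrightarrow> 0"
      by (rule prob_stuck_tendsto_0[OF k_pos c_pos six_k_c_le small spec[OF p_bounds(1)] p_bounds(2)])
  qed (auto intro!: always_eventually prob_arrows_target_le[OF k_ge t_pos])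
qed

section \<open>Cones over complete hypergraphs\<close>

definition cone :: "nat \<Rightarrow> nat \<Rightarrow> 'a set \<Rightarrow> 'a set \<Rightarrow> 'a set \<Rightarrow> bool" where
  "cone k r V F U \<longleftrightarrow> finite V \<and> F \<union> U \<subseteq> V \<and> F \<inter> U = {} \<and> card F + r = Suc k"

definition cone_facets :: "'a set \<Rightarrow> 'a set \<Rightarrow> 'a set set" where
  "cone_facets F Q = facets (F \<union> Q) Q"

definition overlaps :: "'a set \<Rightarrow> 'a set \<Rightarrow> nat \<Rightarrow> ('a set \<times> 'a set) set" where
  "overlaps F U r = {(Q, Q'). Q \<in> nsets U r \<and> Q' \<in> nsets U r \<and> Q \<noteq> Q' \<and>
     cone_facets F Q \<inter> cone_facets F Q' \<noteq> {}}"

lemma card_cone_facets: "card (cone_facets F Q) = card Q"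
  by (simp add: cone_facets_def card_facets)

lemma cone_mono: "cone k r V F U \<Longrightarrow> V \<subseteq> V' \<Longrightarrow> finite V' \<Longrightarrow> cone k r V' F U"
  by (auto simp: cone_def)

lemma coneD:
  assumes "cone k r V F U"
  shows "finite V" "finite F" "finite U" "F \<union> U \<subseteq> V" "F \<inter> U = {}" "card F + r = Suc k"
  using assms finite_subset[of F V] finite_subset[of U V] by (auto simp: cone_def)

lemma card_cone_vertices:
  assumes "cone k r V F U" "Q \<in> nsets U r"
  shows "card (F \<union> Q) = Suc k"
proof -
  note cone = coneD[OF assms(1)]
  have "card (F \<union> Q) = card F + card Q"
    using assms(2) cone(2,5) by (intro card_Un_disjoint) (auto simp: nsets_def)
  then show ?thesis using assms(2) cone(6) by (simp add: nsets_def)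
qed

lemma cone_facets_subset_nsets:
  assumes "cone k r V F U" "Q \<in> nsets U r"
  shows "cone_facets F Q \<subseteq> nsets V k"
  unfolding cone_facets_def using card_cone_vertices[OF assms] coneD[OF assms(1)] assms(2)
  by (intro facets_subset_nsets) (auto simp: nsets_def)

lemma triangle_cone_facets:
  assumes "cone k 3 V F U" "Q \<in> nsets U 3"
  shows "triangle k (cone_facets F Q)"
  unfolding cone_facets_def using card_cone_vertices[OF assms] assms(2)
  by (intro triangle_facets) (auto simp: nsets_def)

lemma cone_facets_common_edge:
  assumes Q_nsets: "Q \<in> nsets U r" "Q' \<in> nsets U r" "Q \<noteq> Q'" and apex: "F \<inter> U = {}"
    and common: "e \<in> cone_facets F Q" "e \<in> cone_facets F Q'"
  shows "e = F \<union> (Q \<inter> Q')" and "\<exists>x\<in>Q. \<exists>y\<in>U. Q' = insert y (Q - {x})"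
proof -
  have sub: "Q \<subseteq> U" "Q' \<subseteq> U" "finite Q" "finite Q'" "card Q = card Q'"
    using Q_nsets by (auto simp: nsets_def)
  obtain x where e_minus_x: "x \<in> Q" "e = F \<union> Q - {x}"
    using common(1) by (auto simp: cone_facets_def facets_def)
  obtain y where e_minus_y: "y \<in> Q'" "e = F \<union> Q' - {y}"
    using common(2) by (auto simp: cone_facets_def facets_def)
  have "e \<inter> U = Q - {x}" "e \<inter> U = Q' - {y}" using e_minus_x e_minus_y sub apex by blast+
  then have Diff_eq: "Q - {x} = Q' - {y}" by simp
  have "x \<notin> Q'"
  proof
    assume "x \<in> Q'"
    then have "Q \<subseteq> Q'" using Diff_eq e_minus_x(1) by blast
    then show False using sub Q_nsets(3) card_subset_eq by blast
  qed
  then have "Q \<inter> Q' = Q - {x}" using Diff_eq by blast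
  moreover have "e = F \<union> (Q - {x})" using e_minus_x sub apex by blast
  ultimately show "e = F \<union> (Q \<inter> Q')" by simp
  have "Q' = insert y (Q - {x})" using Diff_eq e_minus_y(1) by blast
  then show "\<exists>x\<in>Q. \<exists>y\<in>U. Q' = insert y (Q - {x})" using e_minus_x(1) e_minus_y(1) sub(2) by blast
qed

lemma finite_overlaps: "finite U \<Longrightarrow> finite (overlaps F U r)"
  by (rule finite_subset[of _ "nsets U r \<times> nsets U r"])
    (auto simp: overlaps_def finite_imp_finite_nsets)

lemma card_overlaps_le:
  assumes "finite U" "F \<inter> U = {}"
  shows "card (overlaps F U r) \<le> (card U choose r) * (r * card U)"
proof -
  let ?g = "\<lambda>Q (x, y). (Q, insert y (Q - {x}))"
  have "overlaps F U r \<subseteq> (\<Union>Q\<in>nsets U r. ?g Q ` (Q \<times> U))"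
  proof
    fix P assume "P \<in> overlaps F U r"
    then obtain Q Q' e where P: "P = (Q, Q')" "Q \<in> nsets U r" "Q' \<in> nsets U r" "Q \<noteq> Q'"
      "e \<in> cone_facets F Q" "e \<in> cone_facets F Q'" by (auto simp: overlaps_def)
    obtain x y where "x \<in> Q" "y \<in> U" "Q' = insert y (Q - {x})"
      using cone_facets_common_edge(2)[OF P(2-4) assms(2) P(5,6)] by blast
    then have "P \<in> ?g Q ` (Q \<times> U)" using P(1) by force
    then show "P \<in> (\<Union>Q\<in>nsets U r. ?g Q ` (Q \<times> U))" using P(2) by blast
  qed
  then have "card (overlaps F U r) \<le> card (\<Union>Q\<in>nsets U r. ?g Q ` (Q \<times> U))"
    using assms(1) by (intro card_mono) (auto simp: finite_imp_finite_nsets nsets_def)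
  also have "\<dots> \<le> (\<Sum>Q\<in>nsets U r. card (?g Q ` (Q \<times> U)))"
    using assms(1) by (intro card_UN_le finite_imp_finite_nsets)
  also have "\<dots> \<le> (\<Sum>Q\<in>nsets U r. r * card U)"
  proof (intro sum_mono)
    fix Q assume "Q \<in> nsets U r"
    then have "finite (Q \<times> U)" "card (Q \<times> U) = r * card U"
      using assms(1) by (auto simp: nsets_def card_cartesian_product)
    then show "card (?g Q ` (Q \<times> U)) \<le> r * card U" using card_image_le by metis
  qed
  also have "\<dots> = (card U choose r) * (r * card U)" by simp
  finally show ?thesis .
qed

lemma card_cone_facets_Un:
  assumes "(Q, Q') \<in> overlaps F U r" "F \<inter> U = {}"
  shows "card (cone_facets F Q \<union> cone_facets F Q') = 2 * r - 1"
proof -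
  have Q_nsets: "Q \<in> nsets U r" "Q' \<in> nsets U r" "Q \<noteq> Q'"
    using assms(1) by (auto simp: overlaps_def)
  then have fin: "finite (cone_facets F Q)" "finite (cone_facets F Q')"
    by (auto simp: cone_facets_def nsets_def intro: finite_facets)
  have "cone_facets F Q \<inter> cone_facets F Q' \<noteq> {}" using assms(1) by (simp add: overlaps_def)
  then have "cone_facets F Q \<inter> cone_facets F Q' = {F \<union> (Q \<inter> Q')}"
    using cone_facets_common_edge(1)[OF Q_nsets assms(2)] by blast
  then show ?thesis
    using card_Un_Int[OF fin] Q_nsets(1,2) by (simp add: card_cone_facets nsets_def)
qed

lemma sum_overlaps_le:
  fixes p :: real
  assumes "finite U" "F \<inter> U = {}" "0 \<le> p"
  shows "(\<Sum>(Q, Q')\<in>overlaps F U r. p ^ card (cone_facets F Q \<union> cone_facets F Q')) \<le>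
    real (card U choose r) * (real r * real (card U)) * p ^ (2 * r - 1)"
proof -
  have "(\<Sum>(Q, Q')\<in>overlaps F U r. p ^ card (cone_facets F Q \<union> cone_facets F Q')) =
      card (overlaps F U r) * p ^ (2 * r - 1)"
    using card_cone_facets_Un[OF _ assms(2)] by (simp add: case_prod_unfold)
  also have "\<dots> \<le> real (card U choose r) * (real r * real (card U)) * p ^ (2 * r - 1)"
    using of_nat_mono[OF card_overlaps_le[OF assms(1,2), of r], where 'a = real] assms(3)
    by (intro mult_right_mono) auto
  finally show ?thesis .
qed

lemma sum_intersecting_cones_le:
  fixes p :: real
  assumes "finite U" "F \<inter> U = {}" "0 \<le> p"
  shows "(\<Sum>(Q, Q') | Q \<in> nsets U r \<and> Q' \<in> nsets U r \<and> cone_facets F Q \<inter> cone_facets F Q' \<noteq> {}.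
      p ^ card (cone_facets F Q \<union> cone_facets F Q')) \<le>
    real (card U choose r) * p ^ r + real (card U choose r) * (real r * real (card U)) * p ^ (2 * r - 1)"
proof -
  let ?w = "\<lambda>(Q, Q'). p ^ card (cone_facets F Q \<union> cone_facets F Q')"
  let ?diagonal = "(\<lambda>Q. (Q, Q)) ` nsets U r"
  have finite: "finite ?diagonal" "finite (overlaps F U r)"
    using assms(1) by (simp_all add: finite_imp_finite_nsets finite_overlaps)
  have "sum ?w {(Q, Q'). Q \<in> nsets U r \<and> Q' \<in> nsets U r \<and> cone_facets F Q \<inter> cone_facets F Q' \<noteq> {}} \<le>
      sum ?w (?diagonal \<union> overlaps F U r)"
    using assms(3) finite by (intro sum_mono2) (auto simp: overlaps_def)
  also have "\<dots> = sum ?w ?diagonal + sum ?w (overlaps F U r)"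
    using finite by (intro sum.union_disjoint) (auto simp: overlaps_def)
  also have "sum ?w ?diagonal = (\<Sum>Q\<in>nsets U r. p ^ card (cone_facets F Q))"
    by (subst sum.reindex) (auto simp: inj_on_def)
  also have "\<dots> = (\<Sum>Q\<in>nsets U r. p ^ r)"
    by (intro sum.cong refl) (simp add: card_cone_facets nsets_def)
  also have "\<dots> = real (card U choose r) * p ^ r" by simp
  finally show ?thesis using sum_overlaps_le[OF assms, of r] by linarith
qed

lemma prob_few_cones_le:
  fixes p :: real
  assumes cone: "cone k r V F U" and r_pos: "1 \<le> r"
    and N: "N = real (card U choose r)" "0 < N" and p_bounds: "0 < p" "p \<le> 1"
  shows "measure_pmf.prob (random_subset (nsets V k) p)
      {E. real (contained_count (cone_facets F) (nsets U r) E) \<le> N * p ^ r / 2} \<le>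
    4 / (N * p ^ r) + 4 * real r * real (card U) / (N * p)"
proof -
  let ?A = "cone_facets F" and ?J = "nsets U r"
  let ?\<Delta> = "\<Sum>(Q, Q') | Q \<in> ?J \<and> Q' \<in> ?J \<and> ?A Q \<inter> ?A Q' \<noteq> {}. p ^ card (?A Q \<union> ?A Q')"
  have "p ^ card (?A Q) = p ^ r" if "Q \<in> ?J" for Q
    using that by (simp add: card_cone_facets nsets_def)
  then have mean: "N * p ^ r = (\<Sum>Q\<in>?J. p ^ card (?A Q))" using N(1) by simp
  have "measure_pmf.prob (random_subset (nsets V k) p)
        {E. real (contained_count ?A ?J E) \<le> N * p ^ r / 2} \<le>
      4 * ?\<Delta> / (N * p ^ r)\<^sup>2"
    using cone_facets_subset_nsets[OF cone] coneD(1,3)[OF cone] p_bounds N(2)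
    by (intro prob_contained_count_le_half mean) (auto simp: finite_imp_finite_nsets)
  also have "\<dots> \<le> 4 * (N * p ^ r + N * (real r * real (card U)) * p ^ (2 * r - 1)) / (N * p ^ r)\<^sup>2"
    using sum_intersecting_cones_le[OF coneD(3,5)[OF cone], of p r] p_bounds N(1)
    by (intro divide_right_mono mult_left_mono) auto
  also have "\<dots> = 4 / (N * p ^ r) + 4 * real r * real (card U) / (N * p)"
  proof -
    have "Suc (2 * r - 1) = r * 2" using r_pos by simp
    then have "p ^ (2 * r - 1) * p = (p ^ r)\<^sup>2" by (metis power_Suc2 power_mult)
    then show ?thesis using p_bounds N(2) by (simp add: field_simps power2_eq_square)
  qed
  finally show ?thesis .
qed

lemma prob_many_overlaps_le:
  fixes p :: real
  assumes cone: "cone k r V F U" and p_bounds: "0 \<le> p" "p \<le> 1" and a_pos: "0 < a"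
  shows "measure_pmf.prob (random_subset (nsets V k) p)
      {E. a \<le> real (contained_count (\<lambda>(Q, Q'). cone_facets F Q \<union> cone_facets F Q') (overlaps F U r) E)} \<le>
    real (card U choose r) * (real r * real (card U)) * p ^ (2 * r - 1) / a"
proof -
  let ?A = "\<lambda>(Q, Q'). cone_facets F Q \<union> cone_facets F Q'"
  have "measure_pmf.prob (random_subset (nsets V k) p)
      {E. a \<le> real (contained_count ?A (overlaps F U r) E)} \<le> (\<Sum>P\<in>overlaps F U r. p ^ card (?A P)) / a"
  proof (rule prob_contained_count_ge[OF _ _ _ p_bounds a_pos])
    show "?A P \<subseteq> nsets V k" if "P \<in> overlaps F U r" for P
      using that cone_facets_subset_nsets[OF cone] by (auto simp: overlaps_def)
  qed (use coneD[OF cone] in \<open>simp_all add: finite_imp_finite_nsets finite_overlaps\<close>)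
  also have "\<dots> \<le> real (card U choose r) * (real r * real (card U)) * p ^ (2 * r - 1) / a"
    using sum_overlaps_le[OF coneD(3,5)[OF cone] p_bounds(1), of r] a_pos
    by (intro divide_right_mono) (auto simp: case_prod_unfold)
  finally show ?thesis .
qed

section \<open>Forcing triangles and stars\<close>

lemma forces_triangle_triangle:
  assumes "finite W" "card W = Suc k" "A \<subseteq> W" "card A = 5" "facets W A \<subseteq> E"
  shows "forces (has_triangle k) (has_triangle k) E"
  unfolding forces_def
proof (intro allI impI)
  fix R
  let ?A = "\<lambda>D. {v \<in> A. W - {v} \<in> D}"
  have triangle: "has_triangle k D" if D: "3 \<le> card (?A D)" for D
  proof -
    obtain B where B: "B \<subseteq> ?A D" "card B = 3"
      by (rule obtain_subset_with_card_n[OF D])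
    then have "B \<subseteq> W" using assms(3) by blast
    then have "triangle k (facets W B)" using triangle_facets assms(2) B(2) by blast
    moreover have "facets W B \<subseteq> D" using B(1) unfolding facets_def by blast
    ultimately show ?thesis unfolding has_triangle_def by blast
  qed
  have fin_A: "finite A" using assms(3,1) by (rule finite_subset)
  have "A \<subseteq> ?A R \<union> ?A (E - R)" using assms(5) unfolding facets_def by blast
  then have "card A \<le> card (?A R \<union> ?A (E - R))" using fin_A by (intro card_mono) simp_all
  also have "\<dots> \<le> card (?A R) + card (?A (E - R))" by (rule card_Un_le)
  finally have "3 \<le> card (?A R) \<or> 3 \<le> card (?A (E - R))" using assms(4) by linarith
  then show "has_triangle k R \<or> has_triangle k (E - R)" using triangle[of R] triangle[of "E - R"]
    by blast
qed

text \<open>Members that overlap no other member are hit in distinct points.\<close>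

lemma card_le_hitting_set:
  assumes "finite J" "finite B" and hit: "\<And>j. j \<in> J \<Longrightarrow> A j \<inter> B \<noteq> {}"
  shows "card J \<le> card B + card {(i, j). i \<in> J \<and> j \<in> J \<and> i \<noteq> j \<and> A i \<inter> A j \<noteq> {}}"
proof -
  let ?O = "{(i, j). i \<in> J \<and> j \<in> J \<and> i \<noteq> j \<and> A i \<inter> A j \<noteq> {}}"
  have fin_O: "finite ?O" by (rule finite_subset[of _ "J \<times> J"]) (use assms(1) in auto)
  have "\<forall>j\<in>J. \<exists>x. x \<in> A j \<inter> B" using hit by blast
  from bchoice[OF this] obtain \<phi> where \<phi>: "\<And>j. j \<in> J \<Longrightarrow> \<phi> j \<in> A j \<inter> B" by blast
  have "inj_on \<phi> (J - fst ` ?O)"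
  proof (rule inj_onI, rule ccontr)
    fix i j assume same_point: "i \<in> J - fst ` ?O" "j \<in> J - fst ` ?O" "\<phi> i = \<phi> j" "i \<noteq> j"
    then have "(i, j) \<in> ?O" using \<phi>[of i] \<phi>[of j] by auto
    then show False using same_point(1) by force
  qed
  then have "card (J - fst ` ?O) \<le> card B"
    using \<phi> assms(2) by (intro card_inj_on_le[of \<phi>]) auto
  moreover have "card J \<le> card (J - fst ` ?O) + card (fst ` ?O)"
    using card_mono[of "(J - fst ` ?O) \<union> fst ` ?O" J] card_Un_le[of "J - fst ` ?O" "fst ` ?O"]
      assms(1) fin_O by force
  moreover have "card (fst ` ?O) \<le> card ?O" using fin_O by (rule card_image_le)
  ultimately show ?thesis by linarith
qed

definition rich_link :: "'a set \<Rightarrow> 'a set \<Rightarrow> nat \<Rightarrow> 'a set set \<Rightarrow> bool" where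
  "rich_link F U t E \<longleftrightarrow>
     card U * t + contained_count (\<lambda>(Q, Q'). cone_facets F Q \<union> cone_facets F Q') (overlaps F U 3) E <
     contained_count (cone_facets F) (nsets U 3) E"

lemma card_star_free_link_le:
  assumes "finite U" "F \<inter> U = {}" "finite F" "Suc (Suc (card F)) = k" "\<not> has_star k t D"
  shows "card (\<Union>u\<in>U. {e \<in> D. insert u F \<subseteq> e}) \<le> card U * t"
proof -
  have "card (\<Union>u\<in>U. {e \<in> D. insert u F \<subseteq> e}) \<le> (\<Sum>u\<in>U. codegree D (insert u F))"
    unfolding codegree_def using assms(1) by (rule card_UN_le)
  also have "\<dots> \<le> (\<Sum>u\<in>U. t)"
  proof (intro sum_mono)
    fix u assume "u \<in> U"
    then have "card (insert u F) = k - 1" using assms(2-4) by (auto simp: card_insert_if)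
    moreover have "insert u F \<notin> heavy_sets k t D" using assms(5) by (auto simp: has_star_def)
    ultimately show "codegree D (insert u F) \<le> t" by (simp add: heavy_sets_def)
  qed
  finally show ?thesis by simp
qed

lemma forces_triangle_star:
  assumes fin_E: "finite E" and cone: "cone k 3 V F U" and rich: "rich_link F U t E"
  shows "forces (has_triangle k) (has_star k t) (E \<inter> Pow (F \<union> U))"
  unfolding forces_def
proof (intro allI impI, rule ccontr)
  let ?A = "cone_facets F"
  fix R assume "R \<subseteq> E \<inter> Pow (F \<union> U)"
  define D where "D = E \<inter> Pow (F \<union> U) - R"
  assume "\<not> (has_triangle k R \<or> has_star k t (E \<inter> Pow (F \<union> U) - R))"
  then have no_triangle: "\<not> has_triangle k R" and no_star: "\<not> has_star k t D"
    by (simp_all add: D_def)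
  define B where "B = (\<Union>u\<in>U. {e \<in> D. insert u F \<subseteq> e})"
  let ?J = "{Q \<in> nsets U 3. ?A Q \<subseteq> E}"
  note F = coneD[OF cone]
  have hit: "?A Q \<inter> B \<noteq> {}" if Q: "Q \<in> ?J" for Q
  proof -
    have sub: "Q \<subseteq> U" "card Q = 3" "?A Q \<subseteq> E" using Q by (auto simp: nsets_def)
    have "triangle k (?A Q)" using Q by (intro triangle_cone_facets[OF cone]) simp
    then have "\<not> ?A Q \<subseteq> R" using no_triangle unfolding has_triangle_def by blast
    then obtain e where e: "e \<in> ?A Q" "e \<notin> R" by blast
    then obtain v where v: "v \<in> Q" "e = F \<union> Q - {v}" by (auto simp: cone_facets_def facets_def)
    have "\<not> Q \<subseteq> {v}" using sub(2) card_mono[of "{v}" Q] by auto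
    then obtain u where u: "u \<in> Q" "u \<noteq> v" by blast
    have "e \<in> D" using e v(2) sub(1,3) unfolding D_def by blast
    moreover have "insert u F \<subseteq> e" using u v sub(1) F(5) by blast
    ultimately have "e \<in> B" using u(1) sub(1) unfolding B_def by blast
    then show ?thesis using e(1) by blast
  qed
  have "finite ?J" using F(3) by (simp add: finite_imp_finite_nsets)
  moreover have "finite B" using fin_E F(3) by (simp add: B_def D_def)
  ultimately have "card ?J \<le> card B + card {(i, j). i \<in> ?J \<and> j \<in> ?J \<and> i \<noteq> j \<and> ?A i \<inter> ?A j \<noteq> {}}"
    using hit by (rule card_le_hitting_set)
  also have "{(i, j). i \<in> ?J \<and> j \<in> ?J \<and> i \<noteq> j \<and> ?A i \<inter> ?A j \<noteq> {}} =
      {P \<in> overlaps F U 3. (\<lambda>(Q, Q'). ?A Q \<union> ?A Q') P \<subseteq> E}"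
    by (auto simp: overlaps_def)
  moreover have "card B \<le> card U * t"
    unfolding B_def using F no_star by (intro card_star_free_link_le) auto
  ultimately show False
    using rich by (simp add: rich_link_def contained_count_def)
qed

text \<open>Without red edges there is no red triangle, so some \<open>(k - 1)\<close>-set has codegree at least \<open>2 t\<close>.\<close>

lemma forces_star_star:
  assumes "finite E" "forces (has_triangle k) (has_star k (2 * t)) E"
  shows "forces (has_star k t) (has_star k t) E"
  unfolding forces_def
proof (intro allI impI)
  fix R assume R_sub: "R \<subseteq> E"
  have "\<not> has_triangle k {}" by (auto simp: has_triangle_def triangle_def)
  then have "has_star k (2 * t) E" using assms(2) by (auto simp: forces_def)
  then obtain S where S: "card S = k - 1" "2 * t \<le> codegree E S"
    by (auto simp: has_star_def heavy_sets_def)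
  have "codegree E S = codegree R S + codegree (E - R) S"
  proof -
    have "{e \<in> E. S \<subseteq> e} = {e \<in> R. S \<subseteq> e} \<union> {e \<in> E - R. S \<subseteq> e}" using R_sub by blast
    then show ?thesis
      unfolding codegree_def using assms(1) finite_subset[OF R_sub]
      by (simp only:) (rule card_Un_disjoint, auto)
  qed
  then have "t \<le> codegree R S \<or> t \<le> codegree (E - R) S" using S(2) by linarith
  then show "has_star k t R \<or> has_star k t (E - R)"
    using S(1) by (auto simp: has_star_def heavy_sets_def)
qed

lemma forces_colouring:
  assumes "forces P Q E"
  shows "P {e \<in> E. c e = b} \<or> Q {e \<in> E. c e = (\<not> b)}"
proof -
  have "E - {e \<in> E. c e = b} = {e \<in> E. c e = (\<not> b)}" by auto
  then show ?thesis using assms[unfolded forces_def, rule_format, of "{e \<in> E. c e = b}"] by auto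
qed

lemma arrows_target:
  assumes E_sub: "E \<subseteq> nsets V k" and k_ge: "2 \<le> k" and t_pos: "0 < t"
    and forces_X: "forces (has_triangle k) (has_triangle k) (E \<inter> Pow X)"
    and forces_Y: "forces (has_triangle k) (has_star k t) (E \<inter> Pow Y)"
    and forces_Z: "forces (has_star k t) (has_star k t) (E \<inter> Pow Z)"
    and disjoint: "X \<inter> Y = {}" "X \<inter> Z = {}" "Y \<inter> Z = {}"
  shows "arrows (V, E) (target k t)"
  unfolding arrows_def
proof
  fix c :: "'a set \<Rightarrow> bool"
  let ?R = "\<lambda>b U. {e \<in> E. c e = b} \<inter> Pow U"
  have restrict: "{e \<in> E \<inter> Pow U. c e = b} = ?R b U" for b U by auto
  obtain b where triangle_X: "has_triangle k (?R b X)"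
    using forces_colouring[OF forces_X, of c True] unfolding restrict by blast
  obtain b' where star_Z: "has_star k t (?R b' Z)"
    using forces_colouring[OF forces_Z, of c True] unfolding restrict by blast
  have "has_triangle k (?R (\<not> b) Y) \<or> has_star k t (?R b Y)"
    using forces_colouring[OF forces_Y, of c "\<not> b"] unfolding restrict by simp
  then consider (star_in_Y) "has_star k t (?R b Y)" | (same_colour) "b' = b"
    | (triangle_in_Y) "has_triangle k (?R (\<not> b) Y)" "b' = (\<not> b)"
    by blast
  then have "\<exists>d U U'. has_triangle k (?R d U) \<and> has_star k t (?R d U') \<and> U \<inter> U' = {}"
  proof cases
    case star_in_Y
    then show ?thesis
      using triangle_X disjoint(1) by (intro exI[of _ b] exI[of _ X] exI[of _ Y] conjI)
  next
    case same_colour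
    then show ?thesis
      using triangle_X star_Z disjoint(2) by (intro exI[of _ b] exI[of _ X] exI[of _ Z]) simp
  next
    case triangle_in_Y
    then show ?thesis using star_Z disjoint(3) by (intro exI[of _ b'] exI[of _ Y] exI[of _ Z]) simp
  qed
  then obtain d U U'
    where same_colour: "has_triangle k (?R d U)" "has_star k t (?R d U')" "U \<inter> U' = {}"
    by (elim exE conjE)
  have "{e \<in> E. c e = d} \<subseteq> nsets V k" using E_sub by blast
  from target_copy[OF this k_ge t_pos same_colour] obtain H
    where H: "subhypergraph H (V, {e \<in> E. c e = d})" "hypergraph_iso H (target k t)" by blast
  from H(1) have "subhypergraph H (V, E)" "\<forall>e\<in>hedges H. c e = d"
    by (auto simp: subhypergraph_def)
  with H(2) show "\<exists>H b. subhypergraph H (V, E) \<and> hypergraph_iso H (target k t) \<and> (\<forall>e\<in>hedges H. c e = b)"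
    by blast
qed

section \<open>The 1-statement\<close>

lemma arrows_target_of_cones:
  assumes fin_V: "finite V" and E_sub: "E \<subseteq> nsets V k" and k_ge: "2 \<le> k" and t_pos: "0 < t"
    and cones: "cone k 5 X F U" "cone k 3 Y F' U'" "cone k 3 Z F'' U''"
    and disjoint: "X \<inter> Y = {}" "X \<inter> Z = {}" "Y \<inter> Z = {}"
    and Q: "Q \<in> nsets U 5" "cone_facets F Q \<subseteq> E"
    and rich: "rich_link F' U' t E" "rich_link F'' U'' (2 * t) E"
  shows "arrows (V, E) (target k t)"
proof (rule arrows_target[OF E_sub k_ge t_pos])
  have fin_E: "finite E" using E_sub finite_imp_finite_nsets[OF fin_V] by (rule finite_subset)
  have sub: "Q \<subseteq> U" "finite Q" "card Q = 5" using Q(1) by (auto simp: nsets_def)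
  have "facets (F \<union> Q) Q \<subseteq> E \<inter> Pow (F \<union> U)"
    using Q(2) sub(1) by (auto simp: cone_facets_def facets_def)
  then show "forces (has_triangle k) (has_triangle k) (E \<inter> Pow (F \<union> U))"
    using card_cone_vertices[OF cones(1) Q(1)] coneD(2)[OF cones(1)] sub
    by (intro forces_triangle_triangle[of "F \<union> Q" k Q]) auto
  show "forces (has_triangle k) (has_star k t) (E \<inter> Pow (F' \<union> U'))"
    by (rule forces_triangle_star[OF fin_E cones(2) rich(1)])
  show "forces (has_star k t) (has_star k t) (E \<inter> Pow (F'' \<union> U''))"
    using forces_triangle_star[OF fin_E cones(3) rich(2)] fin_E by (intro forces_star_star) auto
  show "(F \<union> U) \<inter> (F' \<union> U') = {}" "(F \<union> U) \<inter> (F'' \<union> U'') = {}" "(F' \<union> U') \<inter> (F'' \<union> U'') = {}"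
    using disjoint coneD(4)[OF cones(1)] coneD(4)[OF cones(2)] coneD(4)[OF cones(3)] by auto
qed

lemma prob_not_rich_link_le:
  fixes p :: real
  assumes cone: "cone k 3 V F U" and N: "N = real (card U choose 3)" "0 < N"
    and p_bounds: "0 < p" "p \<le> 1" and dense: "2 * real (card U) * (real t + 1) \<le> N * p ^ 3"
  shows "measure_pmf.prob (random_subset (nsets V k) p) {E. \<not> rich_link F U t E} \<le>
    4 / (N * p ^ 3) + 12 * real (card U) / (N * p) + 3 * N * p ^ 5"
proof -
  let ?prob = "\<lambda>P. measure_pmf.prob (random_subset (nsets V k) p) {E. P E}" and ?m = "real (card U)"
  let ?cones = "contained_count (cone_facets F) (nsets U 3)"
  let ?pairs = "contained_count (\<lambda>(Q, Q'). cone_facets F Q \<union> cone_facets F Q') (overlaps F U 3)"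
  have m_pos: "0 < ?m" using N by (cases "card U = 0") auto
  have "?prob (\<lambda>E. \<not> rich_link F U t E) \<le>
      ?prob (\<lambda>E. real (?cones E) \<le> N * p ^ 3 / 2 \<or> ?m \<le> real (?pairs E))"
  proof (rule prob_random_subset_le_if_imp)
    fix E assume "\<not> rich_link F U t E"
    then have "?cones E \<le> card U * t + ?pairs E" by (simp add: rich_link_def)
    then have "real (?cones E) \<le> ?m * t + real (?pairs E)"
      unfolding of_nat_mult[symmetric] of_nat_add[symmetric] of_nat_le_iff .
    then show "real (?cones E) \<le> N * p ^ 3 / 2 \<or> ?m \<le> real (?pairs E)"
      using dense by (simp add: distrib_left) linarith
  qed
  also have "\<dots> \<le> ?prob (\<lambda>E. real (?cones E) \<le> N * p ^ 3 / 2) + ?prob (\<lambda>E. ?m \<le> real (?pairs E))"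
    by (rule prob_disj_le)
  also have "?prob (\<lambda>E. real (?cones E) \<le> N * p ^ 3 / 2) \<le> 4 / (N * p ^ 3) + 4 * real 3 * ?m / (N * p)"
    by (rule prob_few_cones_le[OF cone _ N p_bounds]) simp
  also have "?prob (\<lambda>E. ?m \<le> real (?pairs E)) \<le> N * (real 3 * ?m) * p ^ (2 * 3 - 1) / ?m"
    unfolding N(1) using p_bounds by (intro prob_many_overlaps_le[OF cone _ _ m_pos]) auto
  also have "N * (real 3 * ?m) * p ^ (2 * 3 - 1) / ?m = 3 * N * p ^ 5" using m_pos by simp
  finally show ?thesis by simp
qed

lemma ex_three_disjoint_subsets:
  assumes "finite V" "3 * a \<le> card V"
  obtains X Y Z where "X \<union> Y \<union> Z \<subseteq> V" "card X = a" "card Y = a" "card Z = a"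
    "X \<inter> Y = {}" "X \<inter> Z = {}" "Y \<inter> Z = {}"
proof -
  obtain X where X: "X \<subseteq> V" "card X = a" "finite X"
    by (rule obtain_subset_with_card_n[of a V]) (use assms(2) in simp_all)
  have card_VX: "card (V - X) = card V - a" using X by (simp add: card_Diff_subset)
  obtain Y where Y: "Y \<subseteq> V - X" "card Y = a" "finite Y"
    by (rule obtain_subset_with_card_n[of a "V - X"]) (use assms(2) card_VX in simp_all)
  have "card (V - X - Y) = card V - a - a" using Y card_VX by (simp add: card_Diff_subset)
  then have "a \<le> card (V - X - Y)" using assms(2) by simp
  then obtain Z where Z: "Z \<subseteq> V - X - Y" "card Z = a" by (rule obtain_subset_with_card_n)
  show ?thesis by (rule that[of X Y Z]) (use X Y Z in auto)
qed

lemma ex_cone: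
  assumes "finite X" "card X = 2 * m" "r \<le> Suc k" "Suc k \<le> r + m"
  obtains F U where "cone k r X F U" "card U = m"
proof -
  obtain U where U: "U \<subseteq> X" "card U = m" "finite U"
    by (rule obtain_subset_with_card_n[of m X]) (use assms(2) in simp_all)
  then have "Suc k - r \<le> card (X - U)" using assms(2,4) by (simp add: card_Diff_subset)
  then obtain F where "F \<subseteq> X - U" "card F = Suc k - r" by (rule obtain_subset_with_card_n)
  then have "cone k r X F U" using U assms(1,3) by (auto simp: cone_def)
  then show ?thesis using U(2) by (rule that)
qed

definition failure_bound :: "nat \<Rightarrow> real \<Rightarrow> real" where
  "failure_bound m p = 4 / (real (m choose 5) * p ^ 5) + 20 * real m / (real (m choose 5) * p) +
     2 * (4 / (real (m choose 3) * p ^ 3) + 12 * real m / (real (m choose 3) * p) +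
       3 * real (m choose 3) * p ^ 5)"

lemma ex_three_disjoint_cones:
  assumes fin_V: "finite V" "6 * m \<le> card V" and k_bounds: "4 \<le> k" "k \<le> m"
  obtains X Y Z F F' F'' U U' U'' where "X \<union> Y \<union> Z \<subseteq> V"
    "X \<inter> Y = {}" "X \<inter> Z = {}" "Y \<inter> Z = {}"
    "cone k 5 X F U" "cone k 3 Y F' U'" "cone k 3 Z F'' U''"
    "card U = m" "card U' = m" "card U'' = m"
proof -
  obtain X Y Z where sub: "X \<union> Y \<union> Z \<subseteq> V"
    and card: "card X = 2 * m" "card Y = 2 * m" "card Z = 2 * m"
    and disjoint: "X \<inter> Y = {}" "X \<inter> Z = {}" "Y \<inter> Z = {}"
    by (rule ex_three_disjoint_subsets[OF fin_V(1), of "2 * m"]) (use fin_V(2) in simp)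
  have fin: "finite X" "finite Y" "finite Z" using sub fin_V(1) finite_subset by auto
  obtain F U where cone_X: "cone k 5 X F U" "card U = m"
    by (rule ex_cone[OF fin(1) card(1), of 5 k]) (use k_bounds in simp_all)
  obtain F' U' where cone_Y: "cone k 3 Y F' U'" "card U' = m"
    by (rule ex_cone[OF fin(2) card(2), of 3 k]) (use k_bounds in simp_all)
  obtain F'' U'' where cone_Z: "cone k 3 Z F'' U''" "card U'' = m"
    by (rule ex_cone[OF fin(3) card(3), of 3 k]) (use k_bounds in simp_all)
  show ?thesis
    by (rule that[OF sub disjoint cone_X(1) cone_Y(1) cone_Z(1) cone_X(2) cone_Y(2) cone_Z(2)])
qed

lemma prob_not_arrows_target_le:
  fixes p :: real
  assumes fin_V: "finite V" "6 * m \<le> card V" and k_bounds: "4 \<le> k" "k \<le> m" and m_ge: "5 \<le> m"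
    and p_bounds: "0 < p" "p \<le> 1" and t_pos: "0 < t"
    and dense: "2 * real m * (2 * real t + 1) \<le> (m choose 3) * p ^ 3"
  shows "measure_pmf.prob (random_subset (nsets V k) p) {E. \<not> arrows (V, E) (target k t)} \<le>
    failure_bound m p"
proof -
  let ?prob = "\<lambda>P. measure_pmf.prob (random_subset (nsets V k) p) {E. P E}"
  let ?N = "real (m choose 3)" and ?N' = "real (m choose 5)"
  obtain X Y Z F F' F'' U U' U'' where sub: "X \<union> Y \<union> Z \<subseteq> V"
    and disjoint: "X \<inter> Y = {}" "X \<inter> Z = {}" "Y \<inter> Z = {}"
    and cones: "cone k 5 X F U" "cone k 3 Y F' U'" "cone k 3 Z F'' U''"
    and card: "card U = m" "card U' = m" "card U'' = m"
    using fin_V k_bounds by (rule ex_three_disjoint_cones)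
  let ?few = "\<lambda>E. real (contained_count (cone_facets F) (nsets U 5) E) \<le> ?N' * p ^ 5 / 2"
  let ?poor = "\<lambda>E. \<not> rich_link F' U' t E" and ?poor' = "\<lambda>E. \<not> rich_link F'' U'' (2 * t) E"
  have "?prob (\<lambda>E. \<not> arrows (V, E) (target k t)) \<le> ?prob (\<lambda>E. ?few E \<or> ?poor E \<or> ?poor' E)"
  proof (rule prob_random_subset_le_if_imp, rule ccontr)
    fix E assume E_sub: "E \<subseteq> nsets V k" and not_arrows: "\<not> arrows (V, E) (target k t)"
      and good: "\<not> (?few E \<or> ?poor E \<or> ?poor' E)"
    have "0 \<le> ?N' * p ^ 5 / 2" using p_bounds by simp
    then have "0 < real (contained_count (cone_facets F) (nsets U 5) E)" using good by linarith
    then obtain Q where Q: "Q \<in> nsets U 5" "cone_facets F Q \<subseteq> E"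
      by (auto simp: contained_count_def card_gt_0_iff)
    have "arrows (V, E) (target k t)"
      using good k_bounds
      by (intro arrows_target_of_cones[OF fin_V(1) E_sub _ t_pos cones disjoint Q]) auto
    then show False using not_arrows by simp
  qed
  also have "\<dots> \<le> ?prob ?few + (?prob ?poor + ?prob ?poor')"
    by (intro order_trans[OF prob_disj_le] add_left_mono prob_disj_le)
  also have "?prob ?few \<le> 4 / (?N' * p ^ 5) + 4 * real 5 * real (card U) / (?N' * p)"
    using cone_mono[OF cones(1) _ fin_V(1)] sub card(1) m_ge p_bounds
    by (intro prob_few_cones_le) auto
  also have "?prob ?poor \<le> 4 / (?N * p ^ 3) + 12 * real (card U') / (?N * p) + 3 * ?N * p ^ 5"
  proof (rule prob_not_rich_link_le[OF cone_mono[OF cones(2) _ fin_V(1)] _ _ p_bounds])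
    have "2 * real m * (real t + 1) \<le> 2 * real m * (2 * real t + 1)" by (intro mult_left_mono) auto
    then show "2 * real (card U') * (real t + 1) \<le> ?N * p ^ 3" using dense card(2) by simp
  qed (use sub card(2) m_ge in auto)
  also have "?prob ?poor' \<le> 4 / (?N * p ^ 3) + 12 * real (card U'') / (?N * p) + 3 * ?N * p ^ 5"
    using dense sub card(3) m_ge
    by (intro prob_not_rich_link_le[OF cone_mono[OF cones(3) _ fin_V(1)] _ _ p_bounds]) auto
  finally show ?thesis using card by (simp add: failure_bound_def mult_ac)
qed

lemma failure_bound_choose_le:
  fixes p :: real
  assumes "5 \<le> m" "0 < p"
  shows "failure_bound m p \<le>
    4 / ((m / 5) ^ 5 * p ^ 5) + 20 * real m / ((m / 5) ^ 5 * p) +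
    2 * (4 / ((m / 3) ^ 3 * p ^ 3) + 12 * real m / ((m / 3) ^ 3 * p) + 3 * real m ^ 3 * p ^ 5)"
proof -
  have choose_5: "(m / 5) ^ 5 \<le> real (m choose 5)"
    using binomial_ge_n_over_k_pow_k[of 5 m, where 'a = real] assms(1) by simp
  have choose_3: "(m / 3) ^ 3 \<le> real (m choose 3)"
    using binomial_ge_n_over_k_pow_k[of 3 m, where 'a = real] assms(1) by simp
  have choose_3_upper: "real (m choose 3) \<le> real m ^ 3"
    unfolding of_nat_power[symmetric] of_nat_le_iff by (rule binomial_le_power)
  have "0 < (m / 5) ^ 5" "0 < (m / 3) ^ 3" using assms(1) by simp_all
  then show ?thesis
    unfolding failure_bound_def using choose_3 choose_3_upper choose_5 assms(2)
    by (intro add_mono mult_left_mono[of _ _ 2] frac_le mult_right_mono mult_left_mono[of _ _ 3]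
        mult_pos_pos) auto
qed

lemma failure_bound_tendsto_0:
  assumes "0 < C"
  shows "(\<lambda>n. failure_bound (n div 6) (C * real n powr (- 2 / 3))) \<longlonglongrightarrow> 0"
proof -
  define m where "m n = real_of_int \<lfloor>real n / 6\<rfloor>" for n
  define q where "q n = C * real n powr (- 2 / 3)" for n
  define h where "h n = 4 / ((m n / 5) ^ 5 * q n ^ 5) + 20 * m n / ((m n / 5) ^ 5 * q n) +
    2 * (4 / ((m n / 3) ^ 3 * q n ^ 3) + 12 * m n / ((m n / 3) ^ 3 * q n) + 3 * m n ^ 3 * q n ^ 5)" for n
  have floor: "real (n div 6) = m n" for n
    by (simp add: m_def floor_divide_of_nat_eq[of n 6, simplified])
  have h: "h \<longlonglongrightarrow> 0" unfolding h_def m_def q_def using assms by real_asymp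
  have upper: "\<forall>\<^sub>F n in sequentially. failure_bound (n div 6) (q n) \<le> h n"
    using eventually_ge_at_top[of 30]
  proof eventually_elim
    case (elim n)
    then have "5 \<le> n div 6" "0 < q n" using assms by (auto simp: q_def)
    from failure_bound_choose_le[OF this] show ?case by (simp add: h_def floor)
  qed
  have "0 \<le> failure_bound (n div 6) (q n)" for n
    unfolding failure_bound_def q_def using assms
    by (intro add_nonneg_nonneg mult_nonneg_nonneg divide_nonneg_nonneg) auto
  then have lower: "\<forall>\<^sub>F n in sequentially. 0 \<le> failure_bound (n div 6) (q n)"
    by (intro always_eventually allI)
  show ?thesis
    using tendsto_sandwich[OF lower upper tendsto_const h] unfolding q_def .
qed

lemma eventually_many_triangles:
  assumes "0 < C" "1944 * a < C ^ 3"
  shows "\<forall>\<^sub>F n in sequentially.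
    2 * real (n div 6) * a \<le> (n div 6 choose 3) * (C * real n powr (- 2 / 3)) ^ 3"
proof -
  define m where "m n = real_of_int \<lfloor>real n / 6\<rfloor>" for n
  define q where "q n = C * real n powr (- 2 / 3)" for n
  have floor: "real (n div 6) = m n" for n
    by (simp add: m_def floor_divide_of_nat_eq[of n 6, simplified])
  have "(\<lambda>n. (m n)\<^sup>2 * q n ^ 3) \<longlonglongrightarrow> (1 / 6)\<^sup>2 * C ^ 3"
    unfolding m_def q_def using assms(1) by real_asymp
  moreover have "54 * a < (1 / 6)\<^sup>2 * C ^ 3" using assms(2) by (simp add: power2_eq_square)
  ultimately have "\<forall>\<^sub>F n in sequentially. 54 * a < (m n)\<^sup>2 * q n ^ 3"
    by (rule order_tendstoD(1))
  then have "\<forall>\<^sub>F n in sequentially. 2 * m n * a \<le> (n div 6 choose 3) * q n ^ 3"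
    using eventually_ge_at_top[of 18]
  proof eventually_elim
    case (elim n)
    have m_nonneg: "0 \<le> m n" by (simp flip: floor)
    have "2 * m n * a = m n / 27 * (54 * a)" by simp
    also have "\<dots> \<le> m n / 27 * ((m n)\<^sup>2 * q n ^ 3)"
      using elim(1) m_nonneg by (intro mult_left_mono) auto
    also have "\<dots> = (m n / 3) ^ 3 * q n ^ 3" by (simp add: power2_eq_square power3_eq_cube)
    also have "\<dots> \<le> (n div 6 choose 3) * q n ^ 3"
      using binomial_ge_n_over_k_pow_k[of 3 "n div 6", where 'a = real] elim(2) assms(1)
      by (intro mult_right_mono) (auto simp: floor q_def)
    finally show ?case .
  qed
  then show ?thesis by (simp add: floor q_def)
qed

lemma prob_arrows_mono:
  assumes "0 \<le> p" "p \<le> q" "q \<le> 1"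
  shows "measure_pmf.prob (random_hypergraph k n p) {G. arrows G F} \<le>
    measure_pmf.prob (random_hypergraph k n q) {G. arrows G F}"
  unfolding prob_arrows_random_hypergraph
proof (rule prob_random_subset_mono[OF _ assms])
  fix E E' assume "E \<subseteq> E'" and arrows: "arrows ({..<n}, E) F"
  show "arrows ({..<n}, E') F"
    unfolding arrows_def
  proof
    fix c :: "nat set \<Rightarrow> bool"
    obtain H b where "subhypergraph H ({..<n}, E)" "hypergraph_iso H F" "\<forall>e\<in>hedges H. c e = b"
      using arrows unfolding arrows_def by blast
    moreover from this(1) have "subhypergraph H ({..<n}, E')"
      using \<open>E \<subseteq> E'\<close> by (auto simp: subhypergraph_def)
    ultimately show "\<exists>H b. subhypergraph H ({..<n}, E') \<and> hypergraph_iso H F \<and> (\<forall>e\<in>hedges H. c e = b)"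
      by blast
  qed
qed (simp add: finite_imp_finite_nsets)

lemma one_statement:
  assumes k_ge: "4 \<le> k" and t_pos: "0 < t"
  shows "\<exists>C>0. \<forall>p :: nat \<Rightarrow> real. (\<forall>n. 0 \<le> p n \<and> p n \<le> 1) \<longrightarrow>
    (\<forall>\<^sub>F n in sequentially. C * real n powr (- 2 / 3) \<le> p n) \<longrightarrow>
    (\<lambda>n. measure_pmf.prob (random_hypergraph k n (p n)) {G. arrows G (target k t)}) \<longlonglongrightarrow> 1"
proof (intro exI conjI allI impI)
  define C where "C = 2000 * (2 * real t + 1)"
  have C_ge: "1 \<le> C" by (simp add: C_def)
  then show C_pos: "0 < C" by simp
  have "C ^ 1 \<le> C ^ 3" using C_ge by (intro power_increasing) auto
  then have C_large: "1944 * (2 * real t + 1) < C ^ 3" by (simp add: C_def)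
  fix p :: "nat \<Rightarrow> real"
  assume p_bounds: "\<forall>n. 0 \<le> p n \<and> p n \<le> 1"
    and p_large: "\<forall>\<^sub>F n in sequentially. C * real n powr (- 2 / 3) \<le> p n"
  let ?prob = "\<lambda>n p. measure_pmf.prob (random_hypergraph k n p) {G. arrows G (target k t)}"
  let ?q = "\<lambda>n. C * real n powr (- 2 / 3)"
  let ?h = "\<lambda>n. failure_bound (n div 6) (?q n)"
  have lower: "\<forall>\<^sub>F n in sequentially. 1 - ?h n \<le> ?prob n (p n)"
    using p_large eventually_many_triangles[OF C_pos C_large]
      eventually_ge_at_top[of "6 * k"] eventually_ge_at_top[of 30]
  proof eventually_elim
    case (elim n)
    have n_div: "6 * (n div 6) \<le> card {..<n}" "k \<le> n div 6" "5 \<le> n div 6" using elim(3,4) by auto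
    have q_bounds: "0 < ?q n" "?q n \<le> 1"
      using C_pos elim(1,4) spec[OF p_bounds, of n] by auto
    let ?M = "random_subset (nsets {..<n} k) (?q n)" and ?S = "{E. arrows ({..<n}, E) (target k t)}"
    have "measure_pmf.prob ?M (- ?S) \<le> ?h n"
      using prob_not_arrows_target_le[OF finite_lessThan n_div(1) k_ge n_div(2,3) q_bounds t_pos elim(2)]
      by (simp add: Collect_neg_eq)
    moreover have "measure_pmf.prob ?M (- ?S) = 1 - measure_pmf.prob ?M ?S"
      using measure_pmf.prob_compl[of ?S ?M] by (simp add: Compl_eq_Diff_UNIV)
    ultimately have "1 - ?h n \<le> ?prob n (?q n)" unfolding prob_arrows_random_hypergraph by linarith
    also have "\<dots> \<le> ?prob n (p n)"
      using q_bounds elim(1) spec[OF p_bounds, of n] by (intro prob_arrows_mono) auto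
    finally show ?case .
  qed
  have "(\<lambda>n. 1 - ?h n) \<longlonglongrightarrow> 1"
    using tendsto_diff[OF tendsto_const failure_bound_tendsto_0[OF C_pos], of 1] by simp
  from tendsto_sandwich[OF lower _ this tendsto_const] show "(\<lambda>n. ?prob n (p n)) \<longlonglongrightarrow> 1"
    by (simp add: measure_pmf.prob_le_1)
qed

theorem theorem1p3:
  fixes k :: nat
  assumes "k \<ge> 4"
  shows "\<exists>(F :: nat hypergraph) (\<theta> :: real) (c :: real) (C :: real).
           uniform_hypergraph k F \<and> c > 0 \<and> C > 0 \<and> 1 < \<theta> \<and> \<theta> < m_density k F \<and>
           (\<forall>p :: nat \<Rightarrow> real. (\<forall>n. 0 \<le> p n \<and> p n \<le> 1) \<longrightarrow>
              ((\<forall>\<^sub>F n in sequentially. p n \<le> c * real n powr (- 1 / \<theta>)) \<longrightarrow>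
                 (\<lambda>n. measure_pmf.prob (random_hypergraph k n (p n)) {G. arrows G F})
                   \<longlonglongrightarrow> 0) \<and>
              ((\<forall>\<^sub>F n in sequentially. p n \<ge> C * real n powr (- 1 / \<theta>)) \<longrightarrow>
                 (\<lambda>n. measure_pmf.prob (random_hypergraph k n (p n)) {G. arrows G F})
                   \<longlonglongrightarrow> 1))"
proof -
  have k_ge: "2 \<le> k" using assms by simp
  let ?F = "target k (12 * k\<^sup>2)"
  obtain c where c_pos: "0 < c" and zero: "\<And>p :: nat \<Rightarrow> real. \<forall>n. 0 \<le> p n \<and> p n \<le> 1 \<Longrightarrow>
      \<forall>\<^sub>F n in sequentially. p n \<le> c * real n powr (- 2 / 3) \<Longrightarrow>
      (\<lambda>n. measure_pmf.prob (random_hypergraph k n (p n)) {G. arrows G ?F}) \<longlonglongrightarrow> 0"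
    using zero_statement[OF k_ge] by blast
  obtain C where C_pos: "0 < C" and one: "\<And>p :: nat \<Rightarrow> real. \<forall>n. 0 \<le> p n \<and> p n \<le> 1 \<Longrightarrow>
      \<forall>\<^sub>F n in sequentially. C * real n powr (- 2 / 3) \<le> p n \<Longrightarrow>
      (\<lambda>n. measure_pmf.prob (random_hypergraph k n (p n)) {G. arrows G ?F}) \<longlonglongrightarrow> 1"
    using one_statement[OF assms, of "12 * k\<^sup>2"] k_ge by auto
  have "(3 / 2 :: real) < m_density k ?F" using m_density_target[OF k_ge, of "12 * k\<^sup>2"] by linarith
  moreover have "- 1 / (3 / 2) = (- 2 / 3 :: real)" by simp
  ultimately show ?thesis
    using uniform_target[OF k_ge] c_pos C_pos zero one
    by (intro exI[of _ ?F] exI[of _ "3 / 2 :: real"] exI[of _ c] exI[of _ C]) simp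
qed

end
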